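(* Let $P \in \mathcal{C}^1([0,1])$ and $Q \in \mathcal{C}^0([0,1])$ be real-valued functions, and suppose there exists $\alpha$ such that $P(x) \ge \alpha > 0$ for all $x \in [0,1]$. Let $$\Gamma(h) = \int_0^1 P(x) h'(x)^2 + Q(x) h(x)^2 \, dx ,$$ and consider the linear second-order differential equation $$(\mathrm{L}) \qquad \frac{d}{dx}\bigl(P(x) u'(x)\bigr) = Q(x) u(x)$$ and the Riccati equation $$(\mathrm{R}) \qquad w'(x) = \frac{w(x)^2}{P(x)} - Q(x) .$$ Then the following conditions are equivalent: (C1) There exists a strictly positive solution $u$ of $(\mathrm{L})$ on $[0,1]$. (C2) There exists a uniformly bounded solution $w$ of $(\mathrm{R})$ on $[0,1]$. (C3) There exists $\gamma > 0$ such that $$\Gamma(h) \ge \gamma \int_0^1 h'(x)^2 + h(x)^2 \, dx \quad \text{for all } h \in \mathcal{H}_0^1 .$$ (C4) Whenever $u$ is a solution of $(\mathrm{L})$ with $u(0) = u(a) = 0$ for some $0 < a \le 1$, $u$ is identically zero on $[0,a]$. (C5) The solution $u$ of $(\mathrm{L})$ on $[0,1]$ satisfying the initial conditions $u(0) = 0$ and $u'(0) = 1$ is positive on $(0,1]$.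
   Context: $\mathcal{C}^k([0,1])$ denotes the $k$ times continuously differentiable real-valued functions on $[0,1]$ (one-sided derivatives at the endpoints). $\mathcal{H}_0^1$ is the space of (absolutely continuous) real-valued functions $h$ on $[0,1]$ with $h'$ square integrable over $[0,1]$ and $h(0) = h(1) = 0$. Solutions of the differential equations are real-valued classical solutions; since $(\mathrm{L})$ is linear with $P \in \mathcal{C}^1$ bounded below by a positive constant and $Q$ continuous, for every choice of $u_0, u_1 \in \mathbb{R}$ it has a unique solution on $[0,1]$ with $u(0) = u_0$, $u'(0) = u_1$. A solution of $(\mathrm{R})$ on $[0,1]$ is a differentiable function $w$ satisfying the equation at every $x \in [0,1]$. *)

theory Defs
  imports "HOL-Analysis.Analysis"
begin

text \<open>Functions on \<open>[0,1]\<close> are represented by total functions on the reals, of which only the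
  values on \<open>[0,1]\<close> matter. Derivatives \<^emph>\<open>within\<close> \<open>[0,1]\<close> are one-sided at the
  endpoints.\<close>

fun Ck_on :: "nat \<Rightarrow> real set \<Rightarrow> (real \<Rightarrow> real) \<Rightarrow> bool" where
  "Ck_on 0 S f \<longleftrightarrow> continuous_on S f"
| "Ck_on (Suc k) S f \<longleftrightarrow>
     (\<exists>f'. (\<forall>x\<in>S. (f has_real_derivative f' x) (at x within S)) \<and> Ck_on k S f')"

text \<open>Absolute continuity of a function; \<open>\<D>\<close> ranges over the finite families of
  non-overlapping compact intervals inside \<open>S\<close>.\<close>

definition abs_continuous_on :: "real set \<Rightarrow> (real \<Rightarrow> real) \<Rightarrow> bool" where
  "abs_continuous_on S f \<longleftrightarrow>
     (\<forall>\<epsilon>>0. \<exists>\<delta>>0. \<forall>\<D> T. \<D> division_of T \<and> T \<subseteq> S \<and> (\<Sum>K\<in>\<D>. Sup K - Inf K) < \<delta> \<longrightarrow>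
        (\<Sum>K\<in>\<D>. \<bar>f (Sup K) - f (Inf K)\<bar>) < \<epsilon>)"

text \<open>For an absolutely continuous \<open>h\<close>, \<open>deriv h\<close> is the derivative almost everywhere on
  \<open>[0,1]\<close>. On the remaining null set it is arbitrary, so it need not be Borel measurable, and
  the integrals are taken with respect to the complete measure \<open>lebesgue\<close>.\<close>

definition H01 :: "(real \<Rightarrow> real) set" where
  "H01 = {h. abs_continuous_on {0..1} h \<and>
             set_integrable lebesgue {0..1} (\<lambda>x. (deriv h x)\<^sup>2) \<and> h 0 = 0 \<and> h 1 = 0}"

definition Gamma_functional :: "(real \<Rightarrow> real) \<Rightarrow> (real \<Rightarrow> real) \<Rightarrow> (real \<Rightarrow> real) \<Rightarrow> real" where
  "Gamma_functional P Q h =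
     (LINT x:{0..1}|lebesgue. P x * (deriv h x)\<^sup>2 + Q x * (h x)\<^sup>2)"

definition solves_L :: "(real \<Rightarrow> real) \<Rightarrow> (real \<Rightarrow> real) \<Rightarrow> (real \<Rightarrow> real) \<Rightarrow> bool" where
  "solves_L P Q u \<longleftrightarrow>
     (\<exists>u'. \<forall>x\<in>{0..1}. (u has_real_derivative u' x) (at x within {0..1}) \<and>
        ((\<lambda>x. P x * u' x) has_real_derivative Q x * u x) (at x within {0..1}))"

definition solves_R :: "(real \<Rightarrow> real) \<Rightarrow> (real \<Rightarrow> real) \<Rightarrow> (real \<Rightarrow> real) \<Rightarrow> bool" where
  "solves_R P Q w \<longleftrightarrow>
     (\<forall>x\<in>{0..1}. (w has_real_derivative (w x)\<^sup>2 / P x - Q x) (at x within {0..1}))"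

definition cond_C1 :: "(real \<Rightarrow> real) \<Rightarrow> (real \<Rightarrow> real) \<Rightarrow> bool" where
  "cond_C1 P Q \<longleftrightarrow> (\<exists>u. solves_L P Q u \<and> (\<forall>x\<in>{0..1}. 0 < u x))"

definition cond_C2 :: "(real \<Rightarrow> real) \<Rightarrow> (real \<Rightarrow> real) \<Rightarrow> bool" where
  "cond_C2 P Q \<longleftrightarrow> (\<exists>w. solves_R P Q w \<and> bounded (w ` {0..1}))"

definition cond_C3 :: "(real \<Rightarrow> real) \<Rightarrow> (real \<Rightarrow> real) \<Rightarrow> bool" where
  "cond_C3 P Q \<longleftrightarrow>
     (\<exists>\<gamma>>0. \<forall>h\<in>H01. Gamma_functional P Q h \<ge>
        \<gamma> * (LINT x:{0..1}|lebesgue. (deriv h x)\<^sup>2 + (h x)\<^sup>2))"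

definition cond_C4 :: "(real \<Rightarrow> real) \<Rightarrow> (real \<Rightarrow> real) \<Rightarrow> bool" where
  "cond_C4 P Q \<longleftrightarrow>
     (\<forall>u a. solves_L P Q u \<and> 0 < a \<and> a \<le> 1 \<and> u 0 = 0 \<and> u a = 0 \<longrightarrow> (\<forall>x\<in>{0..a}. u x = 0))"

definition solves_L_ivp :: "(real \<Rightarrow> real) \<Rightarrow> (real \<Rightarrow> real) \<Rightarrow> (real \<Rightarrow> real) \<Rightarrow> bool" where
  "solves_L_ivp P Q u \<longleftrightarrow>
     solves_L P Q u \<and> u 0 = 0 \<and> (u has_real_derivative 1) (at 0 within {0..1})"

text \<open>The solution of the initial value problem is unique only up to its values outside
  \<open>[0,1]\<close>, so it is not given by a definite description. The first conjunct prevents the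
  second from holding vacuously.\<close>

definition cond_C5 :: "(real \<Rightarrow> real) \<Rightarrow> (real \<Rightarrow> real) \<Rightarrow> bool" where
  "cond_C5 P Q \<longleftrightarrow>
     (\<exists>u. solves_L_ivp P Q u) \<and>
     (\<forall>u. solves_L_ivp P Q u \<longrightarrow> (\<forall>x\<in>{0<..1}. 0 < u x))"

end

theory Submission
  imports Defs
begin

text \<open>
  The implication (C2) \<open>\<Longrightarrow>\<close> (C3) is the calibration argument: if \<open>w\<close> solves (R), then
  \<open>\<Gamma>(h) + \<integral>(w h\<^sup>2)' = \<integral>P (h' + w h / P)\<^sup>2\<close>, and \<open>\<integral>(w h\<^sup>2)' = 0\<close>. To
  gain the constant \<open>\<gamma>\<close>, \<open>w\<close> is replaced by the strict supersolution \<open>m = w + c x E\<close>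
  with \<open>E = exp (2 \<integral> w / P)\<close> and small \<open>c > 0\<close>, for which
  \<open>P z\<^sup>2 + 2 m y z + (Q + m') y\<^sup>2\<close> is uniformly positive definite in \<open>(y, z)\<close>. Integrating
  \<open>(m h\<^sup>2)'\<close> for \<open>h \<in> \<H>\<^sub>0\<^sup>1\<close> requires that an absolutely continuous function is
  differentiable almost everywhere, by Vitali's covering theorem, and is the Henstock--Kurzweil
  integral of its derivative.

  For the rest, \<open>w = - P u' / u\<close> relates (C1) and (C2); in (C3) \<open>\<Longrightarrow>\<close> (C4) the solution
  \<open>u\<close> on \<open>[0,a]\<close>, extended by zero, has \<open>\<Gamma> = 0\<close>; and a small multiple of the solution
  with data \<open>(1,0)\<close>, added to that of (C5), gives (C1).
\<close>

section \<open>Absolutely continuous functions\<close>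

lemma sum_increments_division:
  fixes f :: "real \<Rightarrow> real"
  assumes "p division_of {a..b}" "a \<le> b"
  shows "(\<Sum>K\<in>p. f (Sup K) - f (Inf K)) = f b - f a"
proof -
  \<comment> \<open>On the empty set \<open>Sup\<close> and \<open>Inf\<close> are unspecified, so
    the value 0 is imposed there; this makes the increment additive under cutting an
    interval.\<close>
  let ?f = "\<lambda>K::real set. if K = {} then 0 else f (Sup K) - f (Inf K)"
  interpret operative_real plus 0 ?f
    rewrites "comm_monoid_set.F (+) 0 = sum"
    by standard[1] (auto simp add: sum_def)
  have "sum ?f p = ?f {a..b}"
    using assms(1) by (intro division) auto
  moreover have "sum ?f p = (\<Sum>K\<in>p. f (Sup K) - f (Inf K))"
    using division_ofD(3)[OF assms(1)] by (intro sum.cong) auto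
  ultimately show ?thesis using assms(2) by simp
qed

lemma increment_of_empty_interior:
  fixes f :: "real \<Rightarrow> real"
  assumes "K = cbox u v" "K \<noteq> {}" "interior K = {}"
  shows "f (Sup K) - f (Inf K) = 0"
  using assms by auto

text \<open>The intervals \<open>m\<close> that complete \<open>p\<close> to a division of a
  bounding interval complete every other division of \<open>S\<close> as well. The completed sums
  telescope to the same value, and the contribution of \<open>m\<close> cancels.\<close>

lemma sum_increments_division_cong:
  fixes f :: "real \<Rightarrow> real"
  assumes p: "p division_of S" and q: "q division_of S"
  shows "(\<Sum>K\<in>p. f (Sup K) - f (Inf K)) = (\<Sum>K\<in>q. f (Sup K) - f (Inf K))"
proof (cases "S = {}")
  case True
  with p q show ?thesis by simp
next
  case False
  obtain a b where S: "S \<subseteq> cbox a b"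
    using elementary_subset_cbox[OF p] by blast
  have ab: "a \<le> b" using False S by auto
  obtain r where r: "p \<subseteq> r" "r division_of cbox a b"
    using partial_division_extend_interval[of p a b] p S by blast
  note pD = division_ofD[OF p] and qD = division_ofD[OF q] and rD = division_ofD[OF r(2)]
  define m where "m = r - p"
  have m: "m division_of \<Union>m"
    using division_of_subset[of r m] r(2) by (auto simp: m_def)
  have disj: "interior S \<inter> interior (\<Union>m) = {}"
  proof (rule Int_interior_Union_intervals)
    show "interior S \<inter> interior T = {}" if T: "T \<in> m" for T
    proof -
      have "interior T \<inter> interior (\<Union>p) = {}"
      proof (rule Int_interior_Union_intervals)
        show "interior T \<inter> interior U = {}" if "U \<in> p" for U
          using T that r(1) rD(5)[of T U] by (auto simp: m_def)
      qed (use pD in auto)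
      then show ?thesis using pD(6) by auto
    qed
  qed (use division_ofD(1,4)[OF m] in auto)
  have un: "S \<union> \<Union>m = cbox a b"
    unfolding pD(6)[symmetric] rD(6)[symmetric] using r(1) by (auto simp: m_def)
  have eq: "(\<Sum>K\<in>d. f (Sup K) - f (Inf K)) = f b - f a - (\<Sum>K\<in>m. f (Sup K) - f (Inf K))"
    if d: "d division_of S" for d
  proof -
    note dD = division_ofD[OF d]
    have "(d \<union> m) division_of cbox a b"
      using division_disjoint_union[OF d m disj] un by simp
    then have "(\<Sum>K\<in>d \<union> m. f (Sup K) - f (Inf K)) = f b - f a"
      using ab by (intro sum_increments_division) auto
    moreover have "(\<Sum>K\<in>d \<union> m. f (Sup K) - f (Inf K))
        = (\<Sum>K\<in>d. f (Sup K) - f (Inf K)) + (\<Sum>K\<in>m. f (Sup K) - f (Inf K))"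
    proof (rule sum.union_inter_neutral)
      \<comment> \<open>The two families can share only degenerate intervals, whose increment is
        zero, so counting them twice does no harm.\<close>
      show "\<forall>K\<in>d \<inter> m. f (Sup K) - f (Inf K) = 0"
      proof
        fix K assume K: "K \<in> d \<inter> m"
        have "interior K \<subseteq> interior S \<inter> interior (\<Union>m)"
          using K dD(2) by (auto intro!: interior_mono dest: interior_mono[of K "\<Union>m"])
        then have "interior K = {}" using disj by blast
        moreover obtain u v where "K = cbox u v" using K dD(4) by blast
        ultimately show "f (Sup K) - f (Inf K) = 0"
          using K dD(3) increment_of_empty_interior by blast
      qed
    qed (use dD(1) m in auto)
    ultimately show ?thesis by simp
  qed
  show ?thesis using eq[OF p] eq[OF q] by simp
qed

lemma sum_lengths_division:
  fixes p :: "real set set"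
  assumes "p division_of S"
  shows "(\<Sum>K\<in>p. Sup K - Inf K) = measure lebesgue S"
proof -
  have "(\<Sum>K\<in>p. Sup K - Inf K) = (\<Sum>K\<in>p. measure lebesgue K)"
  proof (intro sum.cong refl)
    fix K assume "K \<in> p"
    then obtain u v where "K = cbox u v" "K \<noteq> {}"
      using division_ofD[OF assms] by metis
    then show "Sup K - Inf K = measure lebesgue K" by auto
  qed
  also have "\<dots> = measure lebesgue S"
    using content_division[OF assms] by simp
  finally show ?thesis .
qed

section \<open>Vitali coverings by finitely many intervals\<close>

text \<open>Vitali's theorem gives countably many disjoint intervals covering \<open>A\<close> up to
  a null set; finitely many of them already cover it up to measure \<open>e\<close>. The relation
  \<open>R\<close> will be a slope condition on the end points.\<close>

lemma Vitali_covering_finite_intervals: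
  fixes A :: "real set"
  assumes A: "A \<in> lmeasurable" and U: "open U" "A \<subseteq> U" and e: "e > 0"
    and fine: "\<And>x d. x \<in> A \<Longrightarrow> d > 0 \<Longrightarrow> \<exists>r s. r < x \<and> x < s \<and> s - r < d \<and> R r s"
  obtains F where "F division_of (\<Union>F)" "\<Union>F \<subseteq> U" "measure lebesgue (A - \<Union>F) < e"
    "\<And>K. K \<in> F \<Longrightarrow> R (Inf K) (Sup K)"
proof -
  \<comment> \<open>Intervals are indexed by their end points; \<open>c\<close> and
    \<open>\<rho>\<close> are midpoint and half length, which turns them into the closed balls of
    the covering theorem.\<close>
  define K where "K = {(r, s). r < s \<and> R r s \<and> {r..s} \<subseteq> U}"
  define c where "c = (\<lambda>i::real\<times>real. (fst i + snd i) / 2)"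
  define \<rho> where "\<rho> = (\<lambda>i::real\<times>real. (snd i - fst i) / 2)"
  have cb: "cball (c i) (\<rho> i) = {fst i..snd i}" for i
    by (simp add: cball_eq_atLeastAtMost c_def \<rho>_def field_simps)
  obtain C where C: "countable C" "C \<subseteq> K"
    "pairwise (\<lambda>i j. disjnt (cball (c i) (\<rho> i)) (cball (c j) (\<rho> j))) C"
    "negligible (A - (\<Union>i\<in>C. cball (c i) (\<rho> i)))"
  proof (rule Vitali_covering_theorem_cballs[of K \<rho> A c])
    show "0 < \<rho> i" if "i \<in> K" for i using that by (auto simp: K_def \<rho>_def)
    show "\<exists>i. i \<in> K \<and> x \<in> cball (c i) (\<rho> i) \<and> \<rho> i < d" if x: "x \<in> A" and d: "0 < d" for x d
    proof -
      obtain \<eta> where \<eta>: "\<eta> > 0" "ball x \<eta> \<subseteq> U"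
        using U x by (meson openE subsetD)
      obtain r s where rs: "r < x" "x < s" "s - r < min d \<eta>" "R r s"
        using fine[OF x, of "min d \<eta>"] d \<eta> by auto
      have "{r..s} \<subseteq> ball x \<eta>" using rs by (auto simp: dist_real_def)
      then have "(r, s) \<in> K" using rs \<eta> by (auto simp: K_def)
      moreover have "\<rho> (r, s) < d" using rs by (simp add: \<rho>_def)
      ultimately show ?thesis using rs cb by (intro exI[of _ "(r, s)"]) auto
    qed
  qed blast
  define I where "I = (\<lambda>i::real\<times>real. {fst i..snd i})"
  have pw: "pairwise (\<lambda>i j. disjnt (I i) (I j)) C" and negl: "negligible (A - (\<Union>i\<in>C. I i))"
    using C(3,4) by (auto simp: I_def cb)
  have Ilt: "fst i < snd i" "R (fst i) (snd i)" "I i \<subseteq> U" if "i \<in> C" for i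
    using subsetD[OF C(2) that] by (auto simp: K_def I_def)
  obtain G where G: "finite G" "G \<subseteq> C" "measure lebesgue (A - (\<Union>i\<in>G. I i)) < e"
  proof (cases "finite C")
    case True
    with negl e show ?thesis by (intro that[of C]) (auto simp: negligible_imp_measure0)
  next
    case False
    define n where "n = from_nat_into C"
    have ran: "range n = C"
      using C(1) False by (auto simp: n_def intro!: range_from_nat_into)
    \<comment> \<open>What the first \<open>k\<close> intervals leave uncovered decreases to a null
      set and has finite measure, so its measure tends to 0.\<close>
    define D where "D = (\<lambda>k. A - (\<Union>i\<in>n ` {..<k}. I i))"
    have D: "D k \<in> lmeasurable" for k
      unfolding D_def using A by (intro fmeasurable.Diff fmeasurable.finite_UN) (auto simp: I_def)
    have "(\<lambda>k. measure lebesgue (D k)) \<longlonglongrightarrow> measure lebesgue (\<Inter>k. D k)"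
    proof (rule Lim_measure_decseq)
      show "decseq D" by (auto simp: D_def decseq_def)
      show "emeasure lebesgue (D i) \<noteq> \<infinity>" for i using D[of i] by (auto simp: fmeasurable_def)
    qed (use D in auto)
    moreover have "(\<Inter>k. D k) = A - (\<Union>i\<in>C. I i)"
      unfolding ran[symmetric] by (auto simp: D_def)
    ultimately have "(\<lambda>k. measure lebesgue (D k)) \<longlonglongrightarrow> 0"
      using negl by (simp add: negligible_imp_measure0)
    then have "\<forall>\<^sub>F k in sequentially. measure lebesgue (D k) < e"
      using e by (rule order_tendstoD)
    then obtain k where "measure lebesgue (D k) < e" by (auto simp: eventually_sequentially)
    with ran show ?thesis by (intro that[of "n ` {..<k}"]) (auto simp: D_def)
  qed
  show thesis
  proof (rule that[of "I ` G"])
    show "I ` G division_of \<Union>(I ` G)"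
    proof (rule division_ofI)
      fix S assume "S \<in> I ` G"
      then obtain i where "S = I i" "i \<in> C" using G by auto
      then show "S \<noteq> {}" "\<exists>a b. S = cbox a b" using Ilt(1)[of i] by (auto simp: I_def)
    next
      fix S T assume "S \<in> I ` G" "T \<in> I ` G" "S \<noteq> T"
      then obtain i j where "S = I i" "T = I j" "i \<in> C" "j \<in> C" "i \<noteq> j"
        using G(2) by blast
      then have "disjnt S T" using pw by (simp add: pairwise_def)
      then show "interior S \<inter> interior T = {}"
        using interior_subset[of S] interior_subset[of T] by (auto simp: disjnt_def)
    qed (use G in auto)
    show "\<Union>(I ` G) \<subseteq> U" using Ilt(3) G by auto
    show "measure lebesgue (A - \<Union>(I ` G)) < e" using G by simp
    show "R (Inf S) (Sup S)" if S: "S \<in> I ` G" for S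
    proof -
      obtain i where "S = I i" "i \<in> C" using G S by auto
      then show ?thesis using Ilt[of i] by (simp add: I_def)
    qed
  qed
qed


section \<open>Differentiability almost everywhere\<close>

lemma abs_continuous_on_imp_continuous_on:
  assumes ac: "abs_continuous_on S f" and S: "is_interval S"
  shows "continuous_on S f"
  unfolding continuous_on_iff
proof (intro ballI allI impI)
  fix x and \<epsilon> :: real assume x: "x \<in> S" and "\<epsilon> > 0"
  then obtain \<delta> where \<delta>: "\<delta> > 0"
    and D: "\<And>\<D> T. \<D> division_of T \<Longrightarrow> T \<subseteq> S \<Longrightarrow> (\<Sum>K\<in>\<D>. Sup K - Inf K) < \<delta> \<Longrightarrow>
        (\<Sum>K\<in>\<D>. \<bar>f (Sup K) - f (Inf K)\<bar>) < \<epsilon>"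
    using ac unfolding abs_continuous_on_def by metis
  have *: "\<bar>f v - f u\<bar> < \<epsilon>" if "u \<in> S" "v \<in> S" "u \<le> v" "v - u < \<delta>" for u v
  proof -
    have "{u..v} \<subseteq> S"
      using mem_is_interval_1_I[OF S that(1,2)] by auto
    moreover have "{{u..v}} division_of {u..v}"
      using division_of_self[of u v] that by simp
    ultimately show ?thesis using D[of "{{u..v}}" "{u..v}"] that by simp
  qed
  show "\<exists>d>0. \<forall>x'\<in>S. dist x' x < d \<longrightarrow> dist (f x') (f x) < \<epsilon>"
  proof (intro exI[of _ \<delta>] conjI \<delta> ballI impI)
    fix y assume "y \<in> S" "dist y x < \<delta>"
    then show "dist (f y) (f x) < \<epsilon>"
      using *[of x y] *[of y x] x by (cases "x \<le> y") (auto simp: dist_real_def abs_minus_commute)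
  qed
qed

lemma abs_continuous_on_uminus:
  assumes "abs_continuous_on S f"
  shows "abs_continuous_on S (\<lambda>x. - f x)"
proof -
  have "\<bar>- f u - - f v\<bar> = \<bar>f u - f v\<bar>" for u v by linarith
  with assms show ?thesis unfolding abs_continuous_on_def by presburger
qed

lemma division_lengths_bounds:
  fixes F :: "real set set"
  assumes F: "F division_of \<Union>F" and U: "\<Union>F \<subseteq> U" "U \<in> lmeasurable" "measure lebesgue (U - A) < e"
    and A: "A \<in> lmeasurable" "measure lebesgue (A - \<Union>F) < e" "A \<subseteq> U"
  shows "\<bar>(\<Sum>K\<in>F. Sup K - Inf K) - measure lebesgue A\<bar> < e"
proof -
  have Fm: "\<Union>F \<in> lmeasurable" by (rule lmeasurable_division[OF F])
  have "measure lebesgue A \<le> measure lebesgue ((A - \<Union>F) \<union> \<Union>F)"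
    using A Fm by (intro measure_mono_fmeasurable) (auto intro!: fmeasurable.Un fmeasurable.Diff)
  also have "\<dots> \<le> measure lebesgue (A - \<Union>F) + measure lebesgue (\<Union>F)"
    using A Fm by (intro measure_Un_le) auto
  finally have 1: "measure lebesgue A < measure lebesgue (\<Union>F) + e" using A by simp
  have "measure lebesgue (\<Union>F) \<le> measure lebesgue U"
    using U Fm by (intro measure_mono_fmeasurable) auto
  also have "\<dots> = measure lebesgue ((U - A) \<union> A)" using A by (simp add: Un_absorb2)
  also have "\<dots> \<le> measure lebesgue (U - A) + measure lebesgue A"
    using A U by (intro measure_Un_le) auto
  finally have 2: "measure lebesgue (\<Union>F) < measure lebesgue A + e" using U by simp
  show ?thesis unfolding sum_lengths_division[OF F] using 1 2 by simp
qed

text \<open>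
  Cover \<open>A\<close>, up to small measure, by disjoint intervals \<open>F\<close> of slope below \<open>p\<close>, and then
  by disjoint intervals \<open>G\<close> of slope above \<open>q\<close> inside \<open>F\<close>. The gaps \<open>H\<close> have small total
  length, so by absolute continuity the increments over \<open>F\<close> and over \<open>G\<close> nearly agree.
\<close>

lemma negligible_two_slopes:
  fixes h :: "real \<Rightarrow> real"
  assumes ac: "abs_continuous_on {a..b} h" and A: "A \<in> lmeasurable" "A \<subseteq> {a<..<b}" and "p < q"
    and lo: "\<And>x d. x \<in> A \<Longrightarrow> d > 0 \<Longrightarrow> \<exists>r s. r < x \<and> x < s \<and> s - r < d \<and> h s - h r < p * (s - r)"
    and hi: "\<And>x d. x \<in> A \<Longrightarrow> d > 0 \<Longrightarrow> \<exists>r s. r < x \<and> x < s \<and> s - r < d \<and> h s - h r > q * (s - r)"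
  shows "negligible A"
proof (rule ccontr)
  assume "\<not> negligible A"
  define m where "m = measure lebesgue A"
  have m: "m > 0"
    using A(1) \<open>\<not> negligible A\<close> by (simp add: m_def negligible_iff_measure zero_less_measure_iff)
  \<comment> \<open>The slopes will give \<open>(q - p) * lG < 2 * \<eta>\<close>, while
    \<open>lG\<close> is at least three quarters of \<open>m\<close>, so that the same product is at
    least \<open>3 * \<eta>\<close>.\<close>
  define \<eta> where "\<eta> = (q - p) * m / 4"
  have \<eta>: "\<eta> > 0" using m \<open>p < q\<close> by (simp add: \<eta>_def)
  obtain \<delta> where \<delta>: "\<delta> > 0"
    and D: "\<And>\<D> T. \<D> division_of T \<Longrightarrow> T \<subseteq> {a..b} \<Longrightarrow> (\<Sum>K\<in>\<D>. Sup K - Inf K) < \<delta> \<Longrightarrow>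
        (\<Sum>K\<in>\<D>. \<bar>h (Sup K) - h (Inf K)\<bar>) < \<eta>"
    using ac \<eta> unfolding abs_continuous_on_def by metis
  \<comment> \<open>The three bounds serve, in order: gaps of length below \<open>3 * e\<close> are
    shorter than \<delta>; \<open>m - 2 * e\<close> is at least \<open>3 * m / 4\<close>; and the
    term \<open>p * lH\<close> costs at most \<eta>. The summand 1 keeps the denominator positive
    when \<open>p = 0\<close>.\<close>
  define e where "e = min (\<delta> / 4) (min (m / 8) (\<eta> / (3 * \<bar>p\<bar> + 1)))"
  have e: "e > 0" "3 * e < \<delta>" "e \<le> m / 8" "3 * \<bar>p\<bar> * e \<le> \<eta>"
  proof -
    show "e > 0" using \<delta> m \<eta> by (auto simp: e_def intro!: divide_pos_pos)
    have "e \<le> \<delta> / 4" unfolding e_def by (rule min.cobounded1)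
    then show "3 * e < \<delta>" using \<delta> by simp
    show "e \<le> m / 8" unfolding e_def by (meson min.cobounded1 min.cobounded2 order_trans)
    have "e \<le> \<eta> / (3 * \<bar>p\<bar> + 1)" by (auto simp: e_def)
    then have "e * (3 * \<bar>p\<bar> + 1) \<le> \<eta>" by (subst (asm) pos_le_divide_eq) auto
    then show "3 * \<bar>p\<bar> * e \<le> \<eta>" using \<open>e > 0\<close> by (simp add: algebra_simps)
  qed
  obtain V where V: "open V" "A \<subseteq> V" "V - A \<in> lmeasurable" "emeasure lebesgue (V - A) < ennreal e"
    using sets_lebesgue_outer_open[of A e] A e by auto
  define U where "U = V \<inter> {a<..<b}"
  have U: "open U" "A \<subseteq> U" "U \<subseteq> {a<..<b}" "U \<in> lmeasurable"
    using V A by (auto simp: U_def intro!: lmeasurable_open bounded_Int)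
  have Ue: "measure lebesgue (U - A) < e"
  proof -
    have "measure lebesgue (V - A) < e"
      using V(3,4) e by (simp add: emeasure_eq_measure2 ennreal_less_iff)
    moreover have "measure lebesgue (U - A) \<le> measure lebesgue (V - A)"
      using V(3) U(4) A by (intro measure_mono_fmeasurable) (auto simp: U_def)
    ultimately show ?thesis by simp
  qed
  obtain F where F: "F division_of \<Union>F" "\<Union>F \<subseteq> U" "measure lebesgue (A - \<Union>F) < e"
    "\<And>K. K \<in> F \<Longrightarrow> h (Sup K) - h (Inf K) < p * (Sup K - Inf K)"
    by (rule Vitali_covering_finite_intervals[OF A(1) U(1,2) e(1), of "\<lambda>r s. h s - h r < p * (s - r)"])
      (use lo in auto)
  \<comment> \<open>The second covering needs an open set around the points to be covered. Passing
    to the interior loses only end points of intervals of \<open>F\<close>, a null set, so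
    \<open>G\<close> still covers \<open>A\<close> up to measure \<open>2 * e\<close>.\<close>
  define B where "B = A \<inter> interior (\<Union>F)"
  have Bm: "B \<in> lmeasurable" unfolding B_def using A by (simp add: fmeasurable_Int_fmeasurable borel_open)
  obtain G where G: "G division_of \<Union>G" "\<Union>G \<subseteq> interior (\<Union>F)" "measure lebesgue (B - \<Union>G) < e"
    "\<And>K. K \<in> G \<Longrightarrow> h (Sup K) - h (Inf K) > q * (Sup K - Inf K)"
  proof (rule Vitali_covering_finite_intervals[OF Bm _ _ e(1), of "interior (\<Union>F)" "\<lambda>r s. h s - h r > q * (s - r)"])
    fix x d assume "x \<in> B" "d > (0::real)"
    then show "\<exists>r s. r < x \<and> x < s \<and> s - r < d \<and> q * (s - r) < h s - h r"
      using hi[of x d] by (auto simp: B_def)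
  qed (auto simp: B_def)
  have GF: "\<Union>G \<subseteq> \<Union>F" using G(2) interior_subset by blast
  obtain r where r: "G \<subseteq> r" "r division_of \<Union>F"
    using partial_division_extend[OF G(1) F(1) GF] by blast
  define H where "H = r - G"
  have H: "H division_of \<Union>H"
    using division_of_subset[of r H] r by (auto simp: H_def)
  \<comment> \<open>Used twice: with the identity for the lengths and with \<open>h\<close> for the
    increments.\<close>
  have split: "(\<Sum>K\<in>F. f (Sup K) - f (Inf K))
      = (\<Sum>K\<in>G. f (Sup K) - f (Inf K)) + (\<Sum>K\<in>H. f (Sup K) - f (Inf K))" for f :: "real \<Rightarrow> real"
  proof -
    have "(\<Sum>K\<in>F. f (Sup K) - f (Inf K)) = (\<Sum>K\<in>r. f (Sup K) - f (Inf K))"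
      by (rule sum_increments_division_cong[OF F(1) r(2)])
    also have "\<dots> = (\<Sum>K\<in>H. f (Sup K) - f (Inf K)) + (\<Sum>K\<in>G. f (Sup K) - f (Inf K))"
      unfolding H_def using r by (intro sum.subset_diff) auto
    finally show ?thesis by simp
  qed
  define lF where "lF = (\<Sum>K\<in>F. Sup K - Inf K)"
  define lG where "lG = (\<Sum>K\<in>G. Sup K - Inf K)"
  define lH where "lH = (\<Sum>K\<in>H. Sup K - Inf K)"
  have l: "lF = lG + lH" using split[of "\<lambda>x. x"] by (simp add: lF_def lG_def lH_def)
  have lFm: "\<bar>lF - m\<bar> < e"
    unfolding lF_def m_def by (rule division_lengths_bounds[OF F(1,2) U(4) Ue A(1) F(3) U(2)])
  have Fm: "\<Union>F \<in> lmeasurable" by (rule lmeasurable_division[OF F(1)])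
  have lGm: "lG > m - 2 * e"
  proof -
    have Gm: "\<Union>G \<in> lmeasurable" by (rule lmeasurable_division[OF G(1)])
    have IFm: "interior (\<Union>F) \<in> lmeasurable"
      using F(1) by (intro lmeasurable_interior elementary_bounded)
    have neg: "negligible (\<Union>F - interior (\<Union>F))"
    proof -
      have "\<Union>F - interior (\<Union>F) \<subseteq> (\<Union>K\<in>F. {Inf K, Sup K})"
      proof
        fix x assume x: "x \<in> \<Union>F - interior (\<Union>F)"
        then obtain K where K: "K \<in> F" "x \<in> K" by blast
        obtain u v where uv: "K = {u..v}" using division_ofD(4)[OF F(1) K(1)] by auto
        have "interior K \<subseteq> interior (\<Union>F)" using K by (intro interior_mono) auto
        with x have "x \<notin> interior K" by auto
        with K uv have "x = u \<or> x = v" by auto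
        with K uv show "x \<in> (\<Union>K\<in>F. {Inf K, Sup K})" by (intro UN_I[of K]) auto
      qed
      moreover have "finite (\<Union>K\<in>F. {Inf K, Sup K})" using F(1) by auto
      ultimately show ?thesis using negligible_finite negligible_subset by blast
    qed
    have "A \<subseteq> ((A - \<Union>F) \<union> (\<Union>F - interior (\<Union>F))) \<union> ((B - \<Union>G) \<union> \<Union>G)"
      by (auto simp: B_def)
    then have "measure lebesgue A \<le> measure lebesgue (((A - \<Union>F) \<union> (\<Union>F - interior (\<Union>F))) \<union> ((B - \<Union>G) \<union> \<Union>G))"
      using A(1) Bm Gm Fm IFm
      by (intro measure_mono_fmeasurable) (auto intro!: fmeasurable.Un fmeasurable.Diff)
    also have "\<dots> \<le> (measure lebesgue (A - \<Union>F) + measure lebesgue (\<Union>F - interior (\<Union>F)))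
        + (measure lebesgue (B - \<Union>G) + measure lebesgue (\<Union>G))"
      using A(1) Bm Gm Fm IFm
      by (intro order_trans[OF measure_Un_le] add_mono measure_Un_le) auto
    also have "measure lebesgue (\<Union>F - interior (\<Union>F)) = 0" by (rule negligible_imp_measure0[OF neg])
    finally show ?thesis using F(3) G(3) by (simp add: m_def lG_def sum_lengths_division[OF G(1)])
  qed
  have "lH < \<delta>" using l lFm lGm e by simp
  moreover have "\<Union>H \<subseteq> {a..b}"
  proof -
    have "\<Union>H \<subseteq> \<Union>F" using division_ofD(6)[OF r(2)] by (auto simp: H_def)
    also have "\<dots> \<subseteq> {a<..<b}" using F(2) U(3) by blast
    finally show ?thesis by auto
  qed
  ultimately have "(\<Sum>K\<in>H. \<bar>h (Sup K) - h (Inf K)\<bar>) < \<eta>"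
    using D[OF H] by (simp add: lH_def)
  then have "(\<Sum>K\<in>H. h (Sup K) - h (Inf K)) > - \<eta>"
    using sum_abs[of "\<lambda>K. h (Sup K) - h (Inf K)" H] by linarith
  moreover have "(\<Sum>K\<in>F. h (Sup K) - h (Inf K)) \<le> p * lF"
    unfolding lF_def sum_distrib_left using F(4) by (intro sum_mono) force
  moreover have "(\<Sum>K\<in>G. h (Sup K) - h (Inf K)) \<ge> q * lG"
    unfolding lG_def sum_distrib_left using G(4) by (intro sum_mono) force
  ultimately have "q * lG < p * lF + \<eta>" using split[of h] by linarith
  then have "(q - p) * lG < p * lH + \<eta>" unfolding l by (simp add: algebra_simps)
  also have "p * lH \<le> \<bar>p\<bar> * (3 * e)"
  proof -
    have "p * lH \<le> \<bar>p\<bar> * \<bar>lH\<bar>" by (simp add: abs_mult[symmetric])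
    also have "\<dots> \<le> \<bar>p\<bar> * (3 * e)"
    proof (intro mult_left_mono)
      have "lH \<ge> 0" unfolding lH_def sum_lengths_division[OF H] by simp
      then show "\<bar>lH\<bar> \<le> 3 * e" using l lFm lGm by simp
    qed auto
    finally show ?thesis .
  qed
  finally have 1: "(q - p) * lG < 2 * \<eta>" using e(4) by (simp add: mult_ac)
  have "(q - p) * (m * 3 / 4) \<le> (q - p) * lG"
    using lGm e(3) \<open>p < q\<close> by (intro mult_left_mono) auto
  moreover have "(q - p) * (m * 3 / 4) = 3 * \<eta>" by (simp add: \<eta>_def)
  ultimately show False using 1 \<eta> by linarith
qed

text \<open>If \<open>A\<close> had measure \<open>m > 0\<close> inside a short ball, disjoint
  intervals there of slope above \<open>2 / m\<close> and total length above \<open>m / 2\<close>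
  would have increments adding up to more than 1, against absolute continuity. Thus \<open>A\<close>
  is locally negligible, hence negligible.\<close>

lemma negligible_infinite_slope:
  fixes h :: "real \<Rightarrow> real"
  assumes ac: "abs_continuous_on {a..b} h" and A: "A \<in> sets lebesgue" "A \<subseteq> {a<..<b}"
    and hi: "\<And>x d c. x \<in> A \<Longrightarrow> d > 0 \<Longrightarrow> \<exists>r s. r < x \<and> x < s \<and> s - r < d \<and> h s - h r > c * (s - r)"
  shows "negligible A"
proof -
  obtain \<delta> where \<delta>: "\<delta> > 0"
    and D: "\<And>\<D> T. \<D> division_of T \<Longrightarrow> T \<subseteq> {a..b} \<Longrightarrow> (\<Sum>K\<in>\<D>. Sup K - Inf K) < \<delta> \<Longrightarrow>
        (\<Sum>K\<in>\<D>. \<bar>h (Sup K) - h (Inf K)\<bar>) < 1"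
    using ac unfolding abs_continuous_on_def by (metis zero_less_one)
  \<comment> \<open>Inside a ball shorter than \<open>\<delta>\<close>, disjoint intervals have total increment below \<open>1\<close>.\<close>
  have "negligible (A \<inter> ball x (\<delta> / 3))" for x
  proof (rule ccontr)
    define U where "U = ball x (\<delta> / 3) \<inter> {a<..<b}"
    define B where "B = A \<inter> ball x (\<delta> / 3)"
    assume "\<not> negligible (A \<inter> ball x (\<delta> / 3))"
    then have nB: "\<not> negligible B" by (simp add: B_def)
    have Bm: "B \<in> lmeasurable"
      unfolding B_def Int_commute[of A] using A(1) by (intro fmeasurable_Int_fmeasurable) auto
    define m where "m = measure lebesgue B"
    have m: "m > 0"
      using Bm nB by (simp add: m_def negligible_iff_measure zero_less_measure_iff)
    have U: "open U" "B \<subseteq> U" using A(2) by (auto simp: U_def B_def)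
    obtain F where F: "F division_of \<Union>F" "\<Union>F \<subseteq> U" "measure lebesgue (B - \<Union>F) < m / 2"
      "\<And>K. K \<in> F \<Longrightarrow> h (Sup K) - h (Inf K) > (2 / m) * (Sup K - Inf K)"
    proof (rule Vitali_covering_finite_intervals[OF Bm U, of "m / 2" "\<lambda>r s. h s - h r > (2 / m) * (s - r)"])
      show "\<exists>r s. r < x \<and> x < s \<and> s - r < d \<and> 2 / m * (s - r) < h s - h r" if "x \<in> B" "d > 0" for x d
        using hi[of x d "2 / m"] that by (auto simp: B_def)
    qed (use m in auto)
    have Fm: "\<Union>F \<in> lmeasurable" by (rule lmeasurable_division[OF F(1)])
    have "m \<le> measure lebesgue ((B - \<Union>F) \<union> \<Union>F)"
      unfolding m_def using Bm Fm
      by (intro measure_mono_fmeasurable) (auto intro!: fmeasurable.Un fmeasurable.Diff)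
    also have "\<dots> \<le> measure lebesgue (B - \<Union>F) + measure lebesgue (\<Union>F)"
      using Bm Fm by (intro measure_Un_le) auto
    finally have lF: "(\<Sum>K\<in>F. Sup K - Inf K) > m / 2"
      using F(3) by (simp add: sum_lengths_division[OF F(1)])
    have "(\<Sum>K\<in>F. Sup K - Inf K) \<le> measure lebesgue (ball x (\<delta> / 3))"
      unfolding sum_lengths_division[OF F(1)]
      using Fm F(2) by (intro measure_mono_fmeasurable) (auto simp: U_def)
    also have "\<dots> < \<delta>" using \<delta> by (simp add: ball_eq_greaterThanLessThan)
    finally have "(\<Sum>K\<in>F. Sup K - Inf K) < \<delta>" .
    moreover have "\<Union>F \<subseteq> {a..b}"
      using F(2) greaterThanLessThan_subseteq_atLeastAtMost_iff[of a b a b] unfolding U_def by blast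
    ultimately have "(\<Sum>K\<in>F. \<bar>h (Sup K) - h (Inf K)\<bar>) < 1"
      using D[OF F(1)] by blast
    moreover have "(\<Sum>K\<in>F. \<bar>h (Sup K) - h (Inf K)\<bar>) \<ge> (2 / m) * (\<Sum>K\<in>F. Sup K - Inf K)"
      unfolding sum_distrib_left using F(4) by (intro sum_mono) force
    moreover have "(2 / m) * (\<Sum>K\<in>F. Sup K - Inf K) > (2 / m) * (m / 2)"
      using lF m by (intro mult_strict_left_mono) auto
    moreover have "(2 / m) * (m / 2) = 1" using m by simp
    ultimately show False by linarith
  qed
  moreover have "openin (top_of_set A) (A \<inter> ball x (\<delta> / 3))" for x
    by (rule openin_open_Int) simp
  ultimately show ?thesis
    unfolding locally_negligible_alt[of A] using \<delta> by (metis IntI centre_in_ball zero_less_divide_iff zero_less_numeral)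
qed

text \<open>For each fixed bound on the length, the straddled points form a union of open intervals.
  This holds for an arbitrary relation \<open>R\<close>, and letting the bound run through a null
  sequence leaves a countable intersection of open sets.\<close>

lemma borel_straddled_points:
  fixes R :: "real \<Rightarrow> real \<Rightarrow> bool"
  shows "{x. \<forall>d>0. \<exists>r s. r < x \<and> x < s \<and> s - r < d \<and> R r s} \<in> sets borel"
proof -
  have "{x. \<forall>d>0. \<exists>r s. r < x \<and> x < s \<and> s - r < d \<and> R r s}
      = (\<Inter>n. \<Union>{{r<..<s} | r s. s - r < inverse (real (Suc n)) \<and> R r s})" (is "?L = ?R")
  proof (rule set_eqI)
    fix x
    have "x \<in> ?R \<longleftrightarrow> (\<forall>n. \<exists>r s. x \<in> {r<..<s} \<and> s - r < inverse (real (Suc n)) \<and> R r s)"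
      by blast
    also have "\<dots> \<longleftrightarrow> x \<in> ?L"
    proof
      assume R: "\<forall>n. \<exists>r s. x \<in> {r<..<s} \<and> s - r < inverse (real (Suc n)) \<and> R r s"
      show "x \<in> ?L"
      proof (intro CollectI allI impI)
        fix d :: real assume "d > 0"
        then obtain n where n: "inverse (real (Suc n)) < d" using reals_Archimedean by blast
        obtain r s where "x \<in> {r<..<s}" "s - r < inverse (real (Suc n))" "R r s" using R by blast
        with n show "\<exists>r s. r < x \<and> x < s \<and> s - r < d \<and> R r s"
          by (intro exI[of _ r] exI[of _ s]) auto
      qed
    next
      assume L: "x \<in> ?L"
      show "\<forall>n. \<exists>r s. x \<in> {r<..<s} \<and> s - r < inverse (real (Suc n)) \<and> R r s"
      proof
        fix n
        have "inverse (real (Suc n)) > 0" by simp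
        then obtain r s where "r < x" "x < s" "s - r < inverse (real (Suc n))" "R r s" using L by blast
        then show "\<exists>r s. x \<in> {r<..<s} \<and> s - r < inverse (real (Suc n)) \<and> R r s"
          by (intro exI[of _ r] exI[of _ s]) auto
      qed
    qed
    finally show "x \<in> ?L \<longleftrightarrow> x \<in> ?R" by simp
  qed
  also have "\<dots> \<in> sets borel"
  proof -
    have "\<Union>{{r<..<s} | r s. s - r < inverse (real (Suc n)) \<and> R r s} \<in> sets borel" for n
      by (rule borel_open, rule open_Union) auto
    then show ?thesis by blast
  qed
  finally show ?thesis .
qed

text \<open>Difference quotients over intervals with \<open>x\<close> inside control those with
  \<open>x\<close> as an end point: by continuity of \<open>h\<close> the other end may be moved to
  \<open>x\<close> in the estimate.\<close>

lemma has_real_derivative_straddle: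
  fixes h :: "real \<Rightarrow> real"
  assumes x: "a < x" "x < b" and cont: "isCont h x"
    and str: "\<And>\<epsilon>. \<epsilon> > 0 \<Longrightarrow> \<exists>d>0. \<forall>r s. a \<le> r \<and> s \<le> b \<and> r < x \<and> x < s \<and> s - r < d \<longrightarrow>
        \<bar>h s - h r - c * (s - r)\<bar> \<le> \<epsilon> * (s - r)"
  shows "(h has_real_derivative c) (at x)"
  unfolding has_field_derivative_def has_derivative_at_alt
proof (intro conjI allI impI bounded_linear_mult_right)
  fix \<epsilon> :: real assume "\<epsilon> > 0"
  then obtain d where d: "d > 0"
    and D: "\<And>r s. a \<le> r \<Longrightarrow> s \<le> b \<Longrightarrow> r < x \<Longrightarrow> x < s \<Longrightarrow> s - r < d \<Longrightarrow>
        \<bar>h s - h r - c * (s - r)\<bar> \<le> \<epsilon> * (s - r)"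
    using str[of \<epsilon>] by metis
  \<comment> \<open>Two points on either side of \<open>x\<close>, each closer than \<rho>, span an
    interval shorter than \<open>d\<close> inside \<open>{a..b}\<close>.\<close>
  define \<rho> where "\<rho> = min (d / 2) (min (x - a) (b - x))"
  have \<rho>: "\<rho> > 0" "\<rho> \<le> d / 2" "\<rho> \<le> x - a" "\<rho> \<le> b - x"
    using d x unfolding \<rho>_def by linarith+
  have lim: "(h \<longlongrightarrow> h x) (at x within T)" for T
    using cont unfolding isCont_def by (rule tendsto_within_subset) simp
  show "\<exists>d>0. \<forall>y. norm (y - x) < d \<longrightarrow> norm (h y - h x - c * (y - x)) \<le> \<epsilon> * norm (y - x)"
  proof (intro exI[of _ \<rho>] conjI \<rho>(1) allI impI)
    fix y assume y: "norm (y - x) < \<rho>"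
    consider "y = x" | "y > x" | "y < x" by linarith
    then show "norm (h y - h x - c * (y - x)) \<le> \<epsilon> * norm (y - x)"
    proof cases
      case 2
      have "\<bar>h y - h x - c * (y - x)\<bar> \<le> \<epsilon> * (y - x)"
      proof (rule tendsto_le)
        show "((\<lambda>r. \<epsilon> * (y - r)) \<longlongrightarrow> \<epsilon> * (y - x)) (at_left x)"
          "((\<lambda>r. \<bar>h y - h r - c * (y - r)\<bar>) \<longlongrightarrow> \<bar>h y - h x - c * (y - x)\<bar>) (at_left x)"
          by (intro tendsto_intros lim)+
        show "\<forall>\<^sub>F r in at_left x. \<bar>h y - h r - c * (y - r)\<bar> \<le> \<epsilon> * (y - r)"
          unfolding eventually_at_left_field
          using \<rho> y 2 by (intro exI[of _ "x - \<rho>"] conjI allI impI D) auto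
      qed simp
      then show ?thesis using 2 by simp
    next
      case 3
      have "\<bar>h x - h y - c * (x - y)\<bar> \<le> \<epsilon> * (x - y)"
      proof (rule tendsto_le)
        show "((\<lambda>s. \<epsilon> * (s - y)) \<longlongrightarrow> \<epsilon> * (x - y)) (at_right x)"
          "((\<lambda>s. \<bar>h s - h y - c * (s - y)\<bar>) \<longlongrightarrow> \<bar>h x - h y - c * (x - y)\<bar>) (at_right x)"
          by (intro tendsto_intros lim)+
        show "\<forall>\<^sub>F s in at_right x. \<bar>h s - h y - c * (s - y)\<bar> \<le> \<epsilon> * (s - y)"
          unfolding eventually_at_right_field
          using \<rho> y 3 by (intro exI[of _ "x + \<rho>"] conjI allI impI D) auto
      qed simp
      moreover have "\<bar>h y - h x - c * (y - x)\<bar> = \<bar>h x - h y - c * (x - y)\<bar>"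
        by (simp add: algebra_simps abs_if)
      ultimately show ?thesis using 3 by simp
    qed simp
  qed
qed

text \<open>Points of \<open>up q\<close> have arbitrarily short straddling intervals of slope above
  \<open>q\<close>, points of \<open>lo p\<close> ones of slope below \<open>p\<close>. The null set
  \<open>N\<close> collects the points where a rational gap separates lower from upper slopes, where
  upper slopes are unbounded above, or where lower slopes are unbounded below. At any other interior
  point the upper and lower limits of the slopes agree and are finite.\<close>

lemma abs_continuous_on_negligible_not_differentiable:
  fixes h :: "real \<Rightarrow> real"
  assumes ac: "abs_continuous_on {a..b} h"
  shows "negligible {x \<in> {a..b}. \<not> h field_differentiable at x}"
proof -
  define up where "up = (\<lambda>q. {x. \<forall>d>0. \<exists>r s. r < x \<and> x < s \<and> s - r < d \<and>
      (a \<le> r \<and> s \<le> b \<and> h s - h r > q * (s - r))})"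
  define lo where "lo = (\<lambda>p. {x. \<forall>d>0. \<exists>r s. r < x \<and> x < s \<and> s - r < d \<and>
      (a \<le> r \<and> s \<le> b \<and> h s - h r < p * (s - r))})"
  have up_anti: "up q \<subseteq> up q'" if "q' \<le> q" for q q'
  proof
    fix x assume x: "x \<in> up q"
    show "x \<in> up q'" unfolding up_def
    proof (intro CollectI allI impI)
      fix d :: real assume "d > 0"
      then obtain r s where rs: "r < x" "x < s" "s - r < d" "a \<le> r" "s \<le> b" "h s - h r > q * (s - r)"
        using x unfolding up_def by blast
      moreover have "q' * (s - r) \<le> q * (s - r)" using rs that by (intro mult_right_mono) auto
      ultimately have "h s - h r > q' * (s - r)" by linarith
      with rs show "\<exists>r s. r < x \<and> x < s \<and> s - r < d \<and> (a \<le> r \<and> s \<le> b \<and> h s - h r > q' * (s - r))"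
        by blast
    qed
  qed
  have lo_mono: "lo p \<subseteq> lo p'" if "p \<le> p'" for p p'
  proof
    fix x assume x: "x \<in> lo p"
    show "x \<in> lo p'" unfolding lo_def
    proof (intro CollectI allI impI)
      fix d :: real assume "d > 0"
      then obtain r s where rs: "r < x" "x < s" "s - r < d" "a \<le> r" "s \<le> b" "h s - h r < p * (s - r)"
        using x unfolding lo_def by blast
      moreover have "p * (s - r) \<le> p' * (s - r)" using rs that by (intro mult_right_mono) auto
      ultimately have "h s - h r < p' * (s - r)" by linarith
      with rs show "\<exists>r s. r < x \<and> x < s \<and> s - r < d \<and> (a \<le> r \<and> s \<le> b \<and> h s - h r < p' * (s - r))"
        by blast
    qed
  qed
  have sub: "up q \<subseteq> {a<..<b}" "lo q \<subseteq> {a<..<b}" for q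
    unfolding up_def lo_def by (auto dest!: spec[of _ 1])
  have borel: "up q \<in> sets borel" "lo q \<in> sets borel" for q
    unfolding up_def lo_def by (rule borel_straddled_points)+
  have leb: "up q \<in> sets lebesgue" "lo q \<in> sets lebesgue" for q
    using borel by auto
  \<comment> \<open>Intervals having \<open>x\<close> in their interior make \<open>up q\<close> and \<open>lo p\<close> \<open>G\<^sub>\<delta>\<close> sets.\<close>
  define N where "N = (\<Union>(p, q)\<in>{(p, q) \<in> \<rat> \<times> \<rat>. p < q}. up q \<inter> lo p) \<union> (\<Inter>n. up (real n)) \<union> (\<Inter>n. lo (- real n))"
  have "negligible N"
  proof -
    have "negligible (up q \<inter> lo p)" if "p < q" for p q
    proof (rule negligible_two_slopes[OF ac _ _ that])
      have "up q \<inter> lo p = (up q \<inter> lo p) \<inter> box a b" using sub[of q] by auto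
      also have "\<dots> \<in> lmeasurable"
        unfolding Int_commute[of _ "box a b"] using leb by (intro fmeasurable_Int_fmeasurable) auto
      finally show "up q \<inter> lo p \<in> lmeasurable" .
      show "\<exists>r s. r < x \<and> x < s \<and> s - r < d \<and> h s - h r < p * (s - r)"
        if "x \<in> up q \<inter> lo p" "d > 0" for x d using that unfolding lo_def by blast
      show "\<exists>r s. r < x \<and> x < s \<and> s - r < d \<and> h s - h r > q * (s - r)"
        if "x \<in> up q \<inter> lo p" "d > 0" for x d using that unfolding up_def by blast
    qed (use sub[of q] in auto)
    moreover have "countable {(p, q) \<in> \<rat> \<times> \<rat>. p < (q::real)}"
      by (rule countable_subset[of _ "\<rat> \<times> \<rat>"]) (auto intro: countable_rat)
    ultimately have 1: "negligible (\<Union>(p, q)\<in>{(p, q) \<in> \<rat> \<times> \<rat>. p < q}. up q \<inter> lo p)"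
      by (intro negligible_countable_Union countable_image) auto
    have 2: "negligible (\<Inter>n. up (real n))"
    proof (rule negligible_infinite_slope[OF ac])
      show "\<exists>r s. r < x \<and> x < s \<and> s - r < d \<and> h s - h r > c * (s - r)"
        if x: "x \<in> (\<Inter>n. up (real n))" and d: "d > 0" for x d c
      proof -
        have "x \<in> up c" using x up_anti[of c "real (nat \<lceil>c\<rceil>)"] real_nat_ceiling_ge[of c] by blast
        with d show ?thesis unfolding up_def by blast
      qed
      show "(\<Inter>n. up (real n)) \<subseteq> {a<..<b}" using sub(1) by blast
    qed (use leb in auto)
    have 3: "negligible (\<Inter>n. lo (- real n))"
    proof (rule negligible_infinite_slope[OF abs_continuous_on_uminus[OF ac]])
      show "\<exists>r s. r < x \<and> x < s \<and> s - r < d \<and> - h s - - h r > c * (s - r)"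
        if x: "x \<in> (\<Inter>n. lo (- real n))" and d: "d > 0" for x d c
      proof -
        have "x \<in> lo (- c)"
          using x lo_mono[of "- real (nat \<lceil>c\<rceil>)" "- c"] real_nat_ceiling_ge[of c] by auto
        with d obtain r s where "r < x" "x < s" "s - r < d" "h s - h r < - c * (s - r)"
          unfolding lo_def by blast
        then show ?thesis by (intro exI[of _ r] exI[of _ s]) auto
      qed
      show "(\<Inter>n. lo (- real n)) \<subseteq> {a<..<b}" using sub(2) by blast
    qed (use leb in auto)
    show ?thesis unfolding N_def by (intro negligible_Un 1 2 3)
  qed
  moreover have "h field_differentiable at x" if x: "a < x" "x < b" "x \<notin> N" for x
  proof -
    \<comment> \<open>Clipping at \<open>a\<close> and \<open>b\<close> keeps \<open>x\<close>
      strictly inside, and the length is at most \<open>2 * d / 3\<close>.\<close>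
    have strad: "\<exists>r s. r < x \<and> x < s \<and> s - r < d \<and> a \<le> r \<and> s \<le> b" if "d > 0" for d
      using x that by (intro exI[of _ "max a (x - d / 3)"] exI[of _ "min b (x + d / 3)"]) (auto simp: max_def min_def)
    have notup: "\<exists>d>0. \<forall>r s. a \<le> r \<and> s \<le> b \<and> r < x \<and> x < s \<and> s - r < d \<longrightarrow> h s - h r \<le> q * (s - r)"
      if "x \<notin> up q" for q
      using that unfolding up_def by (auto simp: not_less) (meson not_less)
    have notlo: "\<exists>d>0. \<forall>r s. a \<le> r \<and> s \<le> b \<and> r < x \<and> x < s \<and> s - r < d \<longrightarrow> h s - h r \<ge> p * (s - r)"
      if "x \<notin> lo p" for p
      using that unfolding lo_def by (auto simp: not_less) (meson not_less)
    have sep: "x \<notin> lo p" if "x \<in> up q" "p < q" for p q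
    proof
      assume "x \<in> lo p"
      \<comment> \<open>\<open>N\<close> only involves rational pairs, so two rationals are inserted
        between \<open>p\<close> and \<open>q\<close>, and monotonicity carries \<open>x\<close>
        into the sets indexed by them.\<close>
      obtain p' where p': "p' \<in> \<rat>" "p < p'" "p' < q" using Rats_dense_in_real[OF \<open>p < q\<close>] by blast
      obtain q' where q': "q' \<in> \<rat>" "p' < q'" "q' < q" using Rats_dense_in_real[OF \<open>p' < q\<close>] by blast
      have "x \<in> up q' \<inter> lo p'"
        using up_anti[of q' q] lo_mono[of p p'] that \<open>x \<in> lo p\<close> p' q' by auto
      then have "x \<in> N" using p' q' unfolding N_def by blast
      with x show False by simp
    qed
    obtain n0 where n0: "x \<notin> up (real n0)" using x unfolding N_def by blast
    obtain n1 where n1: "x \<notin> lo (- real n1)" using x unfolding N_def by blast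
    \<comment> \<open>The supremum of \<open>S\<close> is the upper derivative at \<open>x\<close>.
      \<open>S\<close> is bounded by \<open>n0\<close>; it is nonempty because short slopes are at
      least \<open>- n1\<close>, hence strictly above \<open>- n1 - 1\<close>.\<close>
    define S where "S = {q. x \<in> up q}"
    have "- real n1 - 1 \<in> S"
      unfolding S_def up_def
    proof (intro CollectI allI impI)
      fix d :: real assume "d > 0"
      obtain d' where d': "d' > 0" and
        D: "\<And>r s. a \<le> r \<Longrightarrow> s \<le> b \<Longrightarrow> r < x \<Longrightarrow> x < s \<Longrightarrow> s - r < d' \<Longrightarrow> h s - h r \<ge> - real n1 * (s - r)"
        using notlo[OF n1] by blast
      obtain r s where rs: "r < x" "x < s" "s - r < min d d'" "a \<le> r" "s \<le> b"
        using strad[of "min d d'"] \<open>d > 0\<close> d' by auto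
      have "(- real n1 - 1) * (s - r) < - real n1 * (s - r)"
        using rs by (intro mult_strict_right_mono) auto
      also have "\<dots> \<le> h s - h r" using D rs by auto
      finally show "\<exists>r s. r < x \<and> x < s \<and> s - r < d \<and> a \<le> r \<and> s \<le> b \<and> (- real n1 - 1) * (s - r) < h s - h r"
        using rs by auto
    qed
    then have ne: "S \<noteq> {}" by blast
    have "q \<le> real n0" if "q \<in> S" for q
      using up_anti[of "real n0" q] n0 that unfolding S_def by (cases "q \<le> real n0") auto
    then have bdd: "bdd_above S" by (auto simp: bdd_above_def)
    define c where "c = Sup S"
    have "(h has_real_derivative c) (at x)"
    proof (rule has_real_derivative_straddle[OF x(1,2)])
      have "continuous_on {a..b} h" by (rule abs_continuous_on_imp_continuous_on[OF ac]) simp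
      then show "isCont h x" using x by (simp add: continuous_on_interior)
      fix \<epsilon> :: real assume \<epsilon>: "\<epsilon> > 0"
      \<comment> \<open>Short slopes cannot exceed \<open>c + \<epsilon>\<close>, as
        \<open>c\<close> is the supremum. They cannot fall below \<open>c - \<epsilon>\<close>
        either: some \<open>q\<close> in \<open>S\<close> exceeds that value, and \<open>sep\<close>
        then excludes \<open>x\<close> from \<open>lo (c - \<epsilon>)\<close>.\<close>
      have "x \<notin> up (c + \<epsilon>)"
      proof
        assume "x \<in> up (c + \<epsilon>)"
        then have "c + \<epsilon> \<le> c" unfolding c_def by (intro cSup_upper bdd) (simp add: S_def)
        with \<epsilon> show False by simp
      qed
      then obtain d1 where d1: "d1 > 0" and
        D1: "\<And>r s. a \<le> r \<Longrightarrow> s \<le> b \<Longrightarrow> r < x \<Longrightarrow> x < s \<Longrightarrow> s - r < d1 \<Longrightarrow> h s - h r \<le> (c + \<epsilon>) * (s - r)"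
        using notup by blast
      have "c - \<epsilon> < Sup S" using \<epsilon> by (simp add: c_def)
      then obtain q where q: "q \<in> S" "c - \<epsilon> < q" using less_cSupD[OF ne] by blast
      then have "x \<notin> lo (c - \<epsilon>)" using sep[of q "c - \<epsilon>"] by (simp add: S_def)
      then obtain d2 where d2: "d2 > 0" and
        D2: "\<And>r s. a \<le> r \<Longrightarrow> s \<le> b \<Longrightarrow> r < x \<Longrightarrow> x < s \<Longrightarrow> s - r < d2 \<Longrightarrow> h s - h r \<ge> (c - \<epsilon>) * (s - r)"
        using notlo by blast
      show "\<exists>d>0. \<forall>r s. a \<le> r \<and> s \<le> b \<and> r < x \<and> x < s \<and> s - r < d \<longrightarrow>
          \<bar>h s - h r - c * (s - r)\<bar> \<le> \<epsilon> * (s - r)"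
      proof (intro exI[of _ "min d1 d2"] conjI allI impI)
        fix r s assume "a \<le> r \<and> s \<le> b \<and> r < x \<and> x < s \<and> s - r < min d1 d2"
        then have "h s - h r \<le> (c + \<epsilon>) * (s - r)" "h s - h r \<ge> (c - \<epsilon>) * (s - r)"
          using D1 D2 by auto
        then show "\<bar>h s - h r - c * (s - r)\<bar> \<le> \<epsilon> * (s - r)"
          unfolding distrib_right left_diff_distrib by linarith
      qed (use d1 d2 in auto)
    qed
    then show ?thesis by (auto simp: field_differentiable_def)
  qed
  then have "{x \<in> {a..b}. \<not> h field_differentiable at x} \<subseteq> N \<union> {a, b}" by force
  ultimately show ?thesis
    by (meson negligible_Un negligible_finite negligible_subset finite.emptyI finite.insertI)
qed

section \<open>The fundamental theorem for absolutely continuous functions\<close>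

text \<open>For tags outside \<open>N\<close>, differentiability supplies a gauge making each
  Riemann term agree with the increment of \<open>g\<close> up to \<epsilon> times the length.
  Intervals tagged in \<open>N\<close> are forced into an open set \<open>V\<close> of measure below
  \<delta>, where absolute continuity makes the increments small.\<close>

lemma has_integral_abs_continuous_on:
  fixes g :: "real \<Rightarrow> real"
  assumes ac: "abs_continuous_on {a..b} g" and ab: "a \<le> b" and N: "negligible N"
    and der: "\<And>x. x \<in> {a..b} - N \<Longrightarrow> (g has_real_derivative g' x) (at x within {a..b})"
  shows "(g' has_integral g b - g a) {a..b}"
proof -
  \<comment> \<open>The values of \<open>g'\<close> on \<open>N\<close> are uncontrolled; with 0
    there, tags in \<open>N\<close> contribute no Riemann term. The integral does not see the
    change.\<close>
  define f where "f = (\<lambda>x. if x \<in> N then 0 else g' x)"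
  have "(f has_integral g b - g a) (cbox a b)"
    unfolding has_integral
  proof (intro allI impI)
    fix e :: real assume e: "e > 0"
    obtain \<delta> where \<delta>: "\<delta> > 0"
      and D: "\<And>\<D> T. \<D> division_of T \<Longrightarrow> T \<subseteq> {a..b} \<Longrightarrow> (\<Sum>K\<in>\<D>. Sup K - Inf K) < \<delta> \<Longrightarrow>
        (\<Sum>K\<in>\<D>. \<bar>g (Sup K) - g (Inf K)\<bar>) < e / 2"
      using ac e unfolding abs_continuous_on_def by (metis half_gt_zero)
    obtain V where V: "open V" "N \<subseteq> V" "V - N \<in> lmeasurable" "emeasure lebesgue (V - N) < ennreal \<delta>"
      using sets_lebesgue_outer_open[of N \<delta>] N \<delta> by (auto simp: negligible_imp_sets)
    have Vm: "V \<in> lmeasurable" "measure lebesgue V < \<delta>"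
    proof -
      have "V = (V - N) \<union> N" using V by auto
      then show "V \<in> lmeasurable"
        using V(3) negligible_imp_measurable[OF N] by (metis fmeasurable.Un)
      have "measure lebesgue V \<le> measure lebesgue (V - N) + measure lebesgue N"
        using measure_Un_le[of "V - N" lebesgue N] V negligible_imp_sets[OF N] by (auto simp: Un_absorb2)
      then show "measure lebesgue V < \<delta>"
        using V(3,4) \<delta> negligible_imp_measure0[OF N] by (simp add: emeasure_eq_measure2 ennreal_less_iff)
    qed
    \<comment> \<open>The summand 1 covers the case \<open>a = b\<close> and makes the bound below
      \<open>e / 2\<close> strict.\<close>
    define \<epsilon> where "\<epsilon> = e / (2 * (b - a + 1))"
    have \<epsilon>: "\<epsilon> > 0" "\<epsilon> * (b - a) < e / 2"
    proof -
      show "\<epsilon> > 0" using e ab by (simp add: \<epsilon>_def)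
      then have "\<epsilon> * (b - a) < \<epsilon> * (b - a + 1)" by simp
      also have "\<dots> = e / 2" using ab by (simp add: \<epsilon>_def field_simps)
      finally show "\<epsilon> * (b - a) < e / 2" .
    qed
    have "\<exists>d>0. \<forall>y\<in>{a..b}. \<bar>y - x\<bar> < d \<longrightarrow> \<bar>g y - g x - g' x * (y - x)\<bar> \<le> \<epsilon> * \<bar>y - x\<bar>"
      if "x \<in> {a..b} - N" for x
      using der[OF that] \<epsilon>(1) unfolding has_field_derivative_def has_derivative_within_alt by simp
    then obtain d where d: "\<And>x. x \<in> {a..b} - N \<Longrightarrow> d x > 0"
      "\<And>x y. x \<in> {a..b} - N \<Longrightarrow> y \<in> {a..b} \<Longrightarrow> \<bar>y - x\<bar> < d x \<Longrightarrow> \<bar>g y - g x - g' x * (y - x)\<bar> \<le> \<epsilon> * \<bar>y - x\<bar>"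
      by metis
    define \<gamma> where "\<gamma> = (\<lambda>x. if x \<in> N then V else if x \<in> {a..b} then ball x (d x) else ball x 1)"
    have gauge: "gauge \<gamma>"
      unfolding gauge_def using V d(1) by (auto simp: \<gamma>_def)
    have main: "norm ((\<Sum>(x, K)\<in>p. measure lborel K *\<^sub>R f x) - (g b - g a)) < e"
      if p: "p tagged_division_of cbox a b" and fine: "\<gamma> fine p" for p
    proof -
      note pD = tagged_division_ofD[OF p]
      have fin: "finite p" using pD by auto
      define q where "q = {(x, K) \<in> p. x \<in> N}"
      have q: "q \<subseteq> p" by (auto simp: q_def)
      have K: "\<exists>u v. K = {u..v} \<and> u \<le> v \<and> u \<le> x \<and> x \<le> v \<and> {u..v} \<subseteq> {a..b}" if "(x, K) \<in> p" for x K
        using pD(2-4)[OF that] by (metis atLeastAtMost_iff box_real(2) order_trans)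
      have "(\<Sum>(x, K)\<in>p. measure lborel K *\<^sub>R f x) - (g b - g a)
          = (\<Sum>(x, K)\<in>p. measure lborel K *\<^sub>R f x - (g (Sup K) - g (Inf K)))"
        using additive_tagged_division_1[OF ab, of p g] p
        by (simp add: sum_subtractf split_def)
      also have "\<dots> = (\<Sum>(x, K)\<in>p - q. measure lborel K *\<^sub>R f x - (g (Sup K) - g (Inf K)))
          + (\<Sum>(x, K)\<in>q. measure lborel K *\<^sub>R f x - (g (Sup K) - g (Inf K)))"
        using q fin by (rule sum.subset_diff)
      finally have "norm ((\<Sum>(x, K)\<in>p. measure lborel K *\<^sub>R f x) - (g b - g a))
          \<le> \<bar>\<Sum>(x, K)\<in>p - q. measure lborel K *\<^sub>R f x - (g (Sup K) - g (Inf K))\<bar>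
            + \<bar>\<Sum>(x, K)\<in>q. measure lborel K *\<^sub>R f x - (g (Sup K) - g (Inf K))\<bar>"
        by (simp only: real_norm_def abs_triangle_ineq)
      moreover have "\<bar>\<Sum>(x, K)\<in>p - q. measure lborel K *\<^sub>R f x - (g (Sup K) - g (Inf K))\<bar> \<le> \<epsilon> * (b - a)"
      proof -
        have "\<bar>\<Sum>(x, K)\<in>p - q. measure lborel K *\<^sub>R f x - (g (Sup K) - g (Inf K))\<bar> \<le> (\<Sum>(x, K)\<in>p - q. \<epsilon> * measure lborel K)"
        proof (rule order_trans[OF sum_abs], rule sum_mono, clarify)
          fix x K assume xK: "(x, K) \<in> p" "(x, K) \<notin> q"
          obtain u v where uv: "K = {u..v}" "u \<le> x" "x \<le> v" "{u..v} \<subseteq> {a..b}" using K[OF xK(1)] by blast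
          have xN: "x \<in> {a..b} - N" "u \<in> {a..b}" "v \<in> {a..b}" using xK uv by (auto simp: q_def)
          have "K \<subseteq> \<gamma> x" using fine xK(1) by (auto simp: fine_def)
          then have "K \<subseteq> ball x (d x)" using xN by (simp add: \<gamma>_def)
          moreover have "u \<in> K" "v \<in> K" using uv by auto
          ultimately have "u \<in> ball x (d x)" "v \<in> ball x (d x)" by blast+
          then have "\<bar>u - x\<bar> < d x" "\<bar>v - x\<bar> < d x" by (auto simp: dist_real_def)
          then have "\<bar>g u - g x - g' x * (u - x)\<bar> \<le> \<epsilon> * \<bar>u - x\<bar>" "\<bar>g v - g x - g' x * (v - x)\<bar> \<le> \<epsilon> * \<bar>v - x\<bar>"
            using d(2)[OF xN(1)] xN by auto
          then have "\<bar>g u - g x - g' x * (u - x)\<bar> \<le> \<epsilon> * (x - u)" "\<bar>g v - g x - g' x * (v - x)\<bar> \<le> \<epsilon> * (v - x)"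
            using uv by auto
          \<comment> \<open>The increment is split at the tag, so that both ends are compared with
            the tangent line at \<open>x\<close>.\<close>
          moreover have "measure lborel K *\<^sub>R f x - (g (Sup K) - g (Inf K)) =
              (g u - g x - g' x * (u - x)) - (g v - g x - g' x * (v - x))"
            using uv xN by (simp add: f_def algebra_simps)
          ultimately have "\<bar>measure lborel K *\<^sub>R f x - (g (Sup K) - g (Inf K))\<bar> \<le> \<epsilon> * (x - u) + \<epsilon> * (v - x)"
            by linarith
          also have "\<dots> = \<epsilon> * measure lborel K" using uv by (simp add: algebra_simps)
          finally show "\<bar>measure lborel K *\<^sub>R f x - (g (Sup K) - g (Inf K))\<bar> \<le> \<epsilon> * measure lborel K" .
        qed
        also have "\<dots> \<le> (\<Sum>(x, K)\<in>p. \<epsilon> * measure lborel K)"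
          using fin \<epsilon> by (intro sum_mono2) (auto simp: split_def)
        also have "\<dots> = \<epsilon> * (\<Sum>(x, K)\<in>p. measure lborel K)" by (simp add: sum_distrib_left split_def)
        also have "\<dots> = \<epsilon> * (b - a)" using additive_content_tagged_division[OF p] ab by simp
        finally show ?thesis .
      qed
      moreover have "\<bar>\<Sum>(x, K)\<in>q. measure lborel K *\<^sub>R f x - (g (Sup K) - g (Inf K))\<bar> < e / 2"
      proof -
        have qt: "q tagged_division_of \<Union>(snd ` q)"
          using tagged_partial_division_of_Union_self[OF tagged_partial_division_subset] p q
          by (meson tagged_division_of_def)
        have ne: "K \<noteq> {}" if "(x, K) \<in> q" for x K using pD(2) q that by blast
        have qd: "snd ` q division_of \<Union>(snd ` q)"
          by (rule division_of_tagged_division[OF qt])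
        have "\<bar>\<Sum>(x, K)\<in>q. measure lborel K *\<^sub>R f x - (g (Sup K) - g (Inf K))\<bar>
            \<le> (\<Sum>(x, K)\<in>q. \<bar>g (Sup K) - g (Inf K)\<bar>)"
          by (rule order_trans[OF sum_abs], rule sum_mono) (auto simp: q_def f_def)
        \<comment> \<open>To drop the tags, the summand must vanish on every interval with empty
          interior; the guard secures this for the empty one.\<close>
        also have "\<dots> = (\<Sum>(x, K)\<in>q. if K = {} then 0 else \<bar>g (Sup K) - g (Inf K)\<bar>)"
          using ne by (intro sum.cong) auto
        also have "\<dots> = (\<Sum>K\<in>snd ` q. if K = {} then 0 else \<bar>g (Sup K) - g (Inf K)\<bar>)"
          by (rule sum.over_tagged_division_lemma[OF qt]) auto
        also have "\<dots> = (\<Sum>K\<in>snd ` q. \<bar>g (Sup K) - g (Inf K)\<bar>)"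
          using ne by (intro sum.cong) auto
        also have "\<dots> < e / 2"
        proof (rule D[OF qd])
          have "K \<subseteq> {a..b}" if "(x, K) \<in> q" for x K using pD(3)[of x K] q that by auto
          then show "\<Union>(snd ` q) \<subseteq> {a..b}" by force
          have "K \<subseteq> V" if "(x, K) \<in> q" for x K
          proof -
            have "K \<subseteq> \<gamma> x" "x \<in> N" using fine that by (auto simp: fine_def q_def)
            then show ?thesis by (simp add: \<gamma>_def)
          qed
          then have "\<Union>(snd ` q) \<subseteq> V" by force
          then have "measure lebesgue (\<Union>(snd ` q)) \<le> measure lebesgue V"
            using lmeasurable_division[OF qd] Vm(1) by (intro measure_mono_fmeasurable) auto
          then show "(\<Sum>K\<in>snd ` q. Sup K - Inf K) < \<delta>"
            unfolding sum_lengths_division[OF qd] using Vm(2) by simp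
        qed
        finally show ?thesis .
      qed
      ultimately show ?thesis using \<epsilon>(2) by linarith
    qed
    show "\<exists>\<gamma>. gauge \<gamma> \<and> (\<forall>p. p tagged_division_of cbox a b \<and> \<gamma> fine p \<longrightarrow>
        norm ((\<Sum>(x, K)\<in>p. measure lborel K *\<^sub>R f x) - (g b - g a)) < e)"
      by (intro exI[of _ \<gamma>] conjI allI impI gauge main) auto
  qed
  then have "(f has_integral g b - g a) {a..b}" by simp
  then show ?thesis
    by (rule has_integral_spike[OF N, rotated]) (simp add: f_def)
qed

section \<open>Linear systems\<close>

lemma compact_continuous_abs_bound:
  fixes f :: "real \<Rightarrow> real"
  assumes "continuous_on S f" "compact S"
  obtains B where "B > 0" "\<And>x. x \<in> S \<Longrightarrow> \<bar>f x\<bar> \<le> B"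
proof -
  have "bounded (f ` S)"
    using assms by (intro compact_imp_bounded compact_continuous_image)
  then show thesis using that unfolding bounded_pos by auto
qed

text \<open>Picard iteration written as a series: \<open>U n\<close> and \<open>V n\<close> are its
  terms, not the partial sums. Each integration turns the bound
  \<open>C * (M * x) ^ n / fact n\<close> into the next one, so the series and that of the
  derivatives converge uniformly on \<open>{0..1}\<close> and may be differentiated
  termwise.\<close>

lemma linear_system_exists:
  fixes p q :: "real \<Rightarrow> real"
  assumes p: "continuous_on {0..1} p" and q: "continuous_on {0..1} q"
  obtains u v where "u 0 = c" "v 0 = d"
    "\<And>x. x \<in> {0..1} \<Longrightarrow> (u has_real_derivative p x * v x) (at x within {0..1})"
    "\<And>x. x \<in> {0..1} \<Longrightarrow> (v has_real_derivative q x * u x) (at x within {0..1})"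
proof -
  define W where "W = rec_nat (\<lambda>x::real. c, \<lambda>x::real. d)
    (\<lambda>_ (U, V). (\<lambda>x. integral {0..x} (\<lambda>t. p t * V t), \<lambda>x. integral {0..x} (\<lambda>t. q t * U t)))"
  define U where "U = (\<lambda>n. fst (W n))"
  define V where "V = (\<lambda>n. snd (W n))"
  have U0: "U 0 = (\<lambda>x. c)" and V0: "V 0 = (\<lambda>x. d)" by (simp_all add: U_def V_def W_def)
  have US: "U (Suc n) = (\<lambda>x. integral {0..x} (\<lambda>t. p t * V n t))"
    and VS: "V (Suc n) = (\<lambda>x. integral {0..x} (\<lambda>t. q t * U n t))" for n
    by (simp_all add: U_def V_def W_def split: prod.splits)
  have cont: "continuous_on {0..1} (U n) \<and> continuous_on {0..1} (V n)" for n
  proof (induction n)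
    case 0 show ?case by (simp add: U0 V0)
  next
    case (Suc n)
    then show ?case unfolding US VS
      using p q by (intro conjI indefinite_integral_continuous_1 integrable_continuous_real continuous_on_mult) auto
  qed
  have contp: "continuous_on {0..1} (\<lambda>t. p t * V n t)" and contq: "continuous_on {0..1} (\<lambda>t. q t * U n t)" for n
    using p q cont[of n] by (auto intro: continuous_on_mult)
  obtain B1 where B1: "\<And>x. x \<in> {0..1} \<Longrightarrow> \<bar>p x\<bar> \<le> B1"
    using compact_continuous_abs_bound[OF p] by blast
  obtain B2 where B2: "\<And>x. x \<in> {0..1} \<Longrightarrow> \<bar>q x\<bar> \<le> B2"
    using compact_continuous_abs_bound[OF q] by blast
  define M where "M = max (max B1 B2) 0"
  have M: "M \<ge> 0" "\<And>x. x \<in> {0..1} \<Longrightarrow> \<bar>p x\<bar> \<le> M" "\<And>x. x \<in> {0..1} \<Longrightarrow> \<bar>q x\<bar> \<le> M"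
    using B1 B2 by (fastforce simp: M_def le_max_iff_disj)+
  define C where "C = max \<bar>c\<bar> \<bar>d\<bar>"
  have step: "\<bar>integral {0..x} (\<lambda>t. f t * F t)\<bar> \<le> C * (M * x) ^ Suc n / fact (Suc n)"
    if x: "x \<in> {0..1}" and f: "continuous_on {0..1} f" "\<And>t. t \<in> {0..1} \<Longrightarrow> \<bar>f t\<bar> \<le> M"
      and F: "continuous_on {0..1} F" "\<And>t. t \<in> {0..1} \<Longrightarrow> \<bar>F t\<bar> \<le> C * (M * t) ^ n / fact n"
    for x f F n
  proof -
    have sub: "{0..x} \<subseteq> {0..1}" using x by auto
    have der: "((\<lambda>t. C * (M * t) ^ Suc n / fact (Suc n)) has_real_derivative M * (C * (M * t) ^ n / fact n)) (at t within S)" for t S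
    proof -
      have "((\<lambda>t. C * (M * t) ^ Suc n / fact (Suc n)) has_real_derivative
          C * (real (Suc n) * (M * t) ^ n * M) / fact (Suc n)) (at t within S)"
        by (auto intro!: derivative_eq_intros simp del: power_Suc of_nat_Suc fact_Suc)
      also have "C * (real (Suc n) * (M * t) ^ n * M) / fact (Suc n) = M * (C * (M * t) ^ n / fact n)"
        unfolding fact_Suc by (simp del: of_nat_Suc)
      finally show ?thesis .
    qed
    have I: "((\<lambda>t. M * (C * (M * t) ^ n / fact n)) has_integral C * (M * x) ^ Suc n / fact (Suc n) - C * (M * 0) ^ Suc n / fact (Suc n)) {0..x}"
      using x der by (intro fundamental_theorem_of_calculus) (auto simp: has_real_derivative_iff_has_vector_derivative[symmetric])
    have "norm (integral {0..x} (\<lambda>t. f t * F t)) \<le> integral {0..x} (\<lambda>t. M * (C * (M * t) ^ n / fact n))"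
    proof (rule integral_norm_bound_integral)
      show "(\<lambda>t. f t * F t) integrable_on {0..x}"
        using continuous_on_subset[OF f(1) sub] continuous_on_subset[OF F(1) sub]
        by (intro integrable_continuous_real continuous_on_mult)
      show "(\<lambda>t. M * (C * (M * t) ^ n / fact n)) integrable_on {0..x}" using I by blast
      show "norm (f t * F t) \<le> M * (C * (M * t) ^ n / fact n)" if "t \<in> {0..x}" for t
        unfolding real_norm_def abs_mult using that sub f(2) F(2) M(1) by (intro mult_mono) auto
    qed
    also have "\<dots> = C * (M * x) ^ Suc n / fact (Suc n)" using integral_unique[OF I] by simp
    finally show ?thesis by simp
  qed
  have bound: "x \<in> {0..1} \<Longrightarrow> \<bar>U n x\<bar> \<le> C * (M * x) ^ n / fact n \<and> \<bar>V n x\<bar> \<le> C * (M * x) ^ n / fact n" for n x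
  proof (induction n arbitrary: x)
    case 0 then show ?case by (simp add: U0 V0 C_def)
  next
    case (Suc n)
    then show ?case unfolding US VS
      using cont[of n] by (intro conjI step p q M(2,3)) auto
  qed
  have bound': "\<bar>U n x\<bar> \<le> C * (M ^ n / fact n)" "\<bar>V n x\<bar> \<le> C * (M ^ n / fact n)" if "x \<in> {0..1}" for n x
  proof -
    have "C * (M * x) ^ n / fact n \<le> C * (M ^ n / fact n)"
      using that M(1) by (auto intro!: mult_left_mono divide_right_mono power_mono simp: C_def mult_left_le)
    then show "\<bar>U n x\<bar> \<le> C * (M ^ n / fact n)" "\<bar>V n x\<bar> \<le> C * (M ^ n / fact n)"
      using bound[OF that, of n] by auto
  qed
  have sumM: "summable (\<lambda>n. K * (M ^ n / fact n))" for K
    using summable_exp[of M] by (intro summable_mult) (simp add: field_simps)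
  \<comment> \<open>This is the series of derivatives, dominated by a multiple of the exponential
    series at \<open>M\<close>.\<close>
  have unif: "uniform_limit {0..1} (\<lambda>n x. \<Sum>i<n. f x * F i x) (\<lambda>x. \<Sum>i. f x * F i x) sequentially"
    if "\<And>x. x \<in> {0..1} \<Longrightarrow> \<bar>f x\<bar> \<le> M" "\<And>n x. x \<in> {0..1} \<Longrightarrow> \<bar>F n x\<bar> \<le> C * (M ^ n / fact n)"
    for f :: "real \<Rightarrow> real" and F :: "nat \<Rightarrow> real \<Rightarrow> real"
  proof (rule Weierstrass_m_test[OF _ sumM])
    show "norm (f x * F n x) \<le> (M * C) * (M ^ n / fact n)" if "x \<in> {0..1}" for n x
      unfolding real_norm_def abs_mult mult.assoc using that \<open>\<And>x. x \<in> {0..1} \<Longrightarrow> \<bar>f x\<bar> \<le> M\<close> M(1)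
        \<open>\<And>n x. x \<in> {0..1} \<Longrightarrow> \<bar>F n x\<bar> \<le> C * (M ^ n / fact n)\<close> by (intro mult_mono) auto
  qed
  have summ: "summable (\<lambda>n. U n x)" "summable (\<lambda>n. V n x)" if "x \<in> {0..1}" for x
    by (rule summable_comparison_test'[OF sumM[of C], of 0], use bound'[OF that] in simp)+
  have derU: "(U (Suc n) has_real_derivative p x * V n x) (at x within {0..1})"
    and derV: "(V (Suc n) has_real_derivative q x * U n x) (at x within {0..1})" if "x \<in> {0..1}" for n x
    unfolding US VS using contp contq that by (auto intro!: integral_has_real_derivative)
  have U0': "U (Suc n) 0 = 0" "V (Suc n) 0 = 0" for n by (simp_all add: US VS)
  have zero: "(0::real) \<in> {0..1}" by simp
  \<comment> \<open>The series start at index 1: these terms vanish at 0 and have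
    \<open>p x * V n x\<close> and \<open>q x * U n x\<close> as derivatives. The constant terms
    \<open>c\<close> and \<open>d\<close> are added back afterwards.\<close>
  obtain u where u: "\<And>x. x \<in> {0..1} \<Longrightarrow> (\<lambda>n. U (Suc n) x) sums u x"
    "\<And>x. x \<in> {0..1} \<Longrightarrow> (u has_real_derivative (\<Sum>i. p x * V i x)) (at x within {0..1})"
    using has_field_derivative_series[OF convex_closed_interval derU unif[OF M(2) bound'(2)] zero] U0'
    by (simp del: atLeastAtMost_iff) blast
  obtain v where v: "\<And>x. x \<in> {0..1} \<Longrightarrow> (\<lambda>n. V (Suc n) x) sums v x"
    "\<And>x. x \<in> {0..1} \<Longrightarrow> (v has_real_derivative (\<Sum>i. q x * U i x)) (at x within {0..1})"
    using has_field_derivative_series[OF convex_closed_interval derV unif[OF M(3) bound'(1)] zero] U0'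
    by (simp del: atLeastAtMost_iff) blast
  have su: "(\<Sum>n. U n x) = c + u x" "(\<Sum>n. V n x) = d + v x" if "x \<in> {0..1}" for x
    using suminf_split_head[OF summ(1)[OF that]] suminf_split_head[OF summ(2)[OF that]]
      sums_unique[OF u(1)[OF that]] sums_unique[OF v(1)[OF that]] by (simp_all add: U0 V0)
  show thesis
  proof (rule that[of "\<lambda>x. c + u x" "\<lambda>x. d + v x"])
    show "c + u 0 = c" "d + v 0 = d"
      using u(1)[of 0] v(1)[of 0] U0' by (auto simp: sums_iff)
    fix x :: real assume x: "x \<in> {0..1}"
    have "(\<Sum>i. p x * V i x) = p x * (d + v x)" "(\<Sum>i. q x * U i x) = q x * (c + u x)"
      using suminf_mult[OF summ(2)[OF x], of "p x"] suminf_mult[OF summ(1)[OF x], of "q x"] su[OF x] by simp_all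
    then show "((\<lambda>x. c + u x) has_real_derivative p x * (d + v x)) (at x within {0..1})"
      "((\<lambda>x. d + v x) has_real_derivative q x * (c + u x)) (at x within {0..1})"
      using u(2)[OF x] v(2)[OF x] by (auto intro!: derivative_eq_intros)
  qed
qed

section \<open>Coercivity of the energy\<close>

lemma abs_continuous_on_mult:
  fixes f g :: "real \<Rightarrow> real"
  assumes f: "abs_continuous_on {a..b} f" and g: "abs_continuous_on {a..b} g"
  shows "abs_continuous_on {a..b} (\<lambda>x. f x * g x)"
  unfolding abs_continuous_on_def
proof (intro allI impI)
  fix \<epsilon> :: real assume \<epsilon>: "\<epsilon> > 0"
  obtain B where B: "B > 0" "\<And>x. x \<in> {a..b} \<Longrightarrow> \<bar>f x\<bar> \<le> B"
    using compact_continuous_abs_bound[OF abs_continuous_on_imp_continuous_on[OF f]] by auto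
  obtain C where C: "C > 0" "\<And>x. x \<in> {a..b} \<Longrightarrow> \<bar>g x\<bar> \<le> C"
    using compact_continuous_abs_bound[OF abs_continuous_on_imp_continuous_on[OF g]] by auto
  have \<epsilon>': "\<epsilon> / (2 * C) > 0" "\<epsilon> / (2 * B) > 0" using \<epsilon> B C by auto
  obtain \<delta>1 where \<delta>1: "\<delta>1 > 0"
    and D1: "\<And>\<D> T. \<D> division_of T \<Longrightarrow> T \<subseteq> {a..b} \<Longrightarrow> (\<Sum>K\<in>\<D>. Sup K - Inf K) < \<delta>1 \<Longrightarrow>
        (\<Sum>K\<in>\<D>. \<bar>f (Sup K) - f (Inf K)\<bar>) < \<epsilon> / (2 * C)"
    using f \<epsilon>'(1) unfolding abs_continuous_on_def by metis
  obtain \<delta>2 where \<delta>2: "\<delta>2 > 0"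
    and D2: "\<And>\<D> T. \<D> division_of T \<Longrightarrow> T \<subseteq> {a..b} \<Longrightarrow> (\<Sum>K\<in>\<D>. Sup K - Inf K) < \<delta>2 \<Longrightarrow>
        (\<Sum>K\<in>\<D>. \<bar>g (Sup K) - g (Inf K)\<bar>) < \<epsilon> / (2 * B)"
    using g \<epsilon>'(2) unfolding abs_continuous_on_def by metis
  have main: "(\<Sum>K\<in>\<D>. \<bar>f (Sup K) * g (Sup K) - f (Inf K) * g (Inf K)\<bar>) < \<epsilon>"
    if \<D>: "\<D> division_of T" "T \<subseteq> {a..b}" "(\<Sum>K\<in>\<D>. Sup K - Inf K) < min \<delta>1 \<delta>2" for \<D> T
  proof -
    have "(\<Sum>K\<in>\<D>. \<bar>f (Sup K) * g (Sup K) - f (Inf K) * g (Inf K)\<bar>)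
        \<le> (\<Sum>K\<in>\<D>. C * \<bar>f (Sup K) - f (Inf K)\<bar> + B * \<bar>g (Sup K) - g (Inf K)\<bar>)"
    proof (rule sum_mono)
      fix K assume K: "K \<in> \<D>"
      then obtain u v where "K = {u..v}" "K \<noteq> {}" "K \<subseteq> {a..b}"
        using division_ofD(2-4)[OF \<D>(1)] \<D>(2) by (metis box_real(2) order_trans)
      then have uv: "Inf K \<in> {a..b}" "Sup K \<in> {a..b}" by auto
      have "f (Sup K) * g (Sup K) - f (Inf K) * g (Inf K)
          = g (Sup K) * (f (Sup K) - f (Inf K)) + f (Inf K) * (g (Sup K) - g (Inf K))"
        by (simp add: algebra_simps)
      also have "\<bar>\<dots>\<bar> \<le> \<bar>g (Sup K)\<bar> * \<bar>f (Sup K) - f (Inf K)\<bar> + \<bar>f (Inf K)\<bar> * \<bar>g (Sup K) - g (Inf K)\<bar>"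
        unfolding abs_mult[symmetric] by (rule abs_triangle_ineq)
      also have "\<dots> \<le> C * \<bar>f (Sup K) - f (Inf K)\<bar> + B * \<bar>g (Sup K) - g (Inf K)\<bar>"
        using B(2)[OF uv(1)] C(2)[OF uv(2)] by (intro add_mono mult_right_mono) auto
      finally show "\<bar>f (Sup K) * g (Sup K) - f (Inf K) * g (Inf K)\<bar>
          \<le> C * \<bar>f (Sup K) - f (Inf K)\<bar> + B * \<bar>g (Sup K) - g (Inf K)\<bar>" .
    qed
    also have "\<dots> = C * (\<Sum>K\<in>\<D>. \<bar>f (Sup K) - f (Inf K)\<bar>) + B * (\<Sum>K\<in>\<D>. \<bar>g (Sup K) - g (Inf K)\<bar>)"
      by (simp add: sum.distrib sum_distrib_left)
    also have "\<dots> < C * (\<epsilon> / (2 * C)) + B * (\<epsilon> / (2 * B))"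
      using D1[OF \<D>(1,2)] D2[OF \<D>(1,2)] \<D>(3) B(1) C(1)
      by (intro add_strict_mono mult_strict_left_mono) auto
    also have "\<dots> = \<epsilon>" using B(1) C(1) by simp
    finally show ?thesis .
  qed
  show "\<exists>\<delta>>0. \<forall>\<D> T. \<D> division_of T \<and> T \<subseteq> {a..b} \<and> (\<Sum>K\<in>\<D>. Sup K - Inf K) < \<delta> \<longrightarrow>
      (\<Sum>K\<in>\<D>. \<bar>f (Sup K) * g (Sup K) - f (Inf K) * g (Inf K)\<bar>) < \<epsilon>"
    using \<delta>1 \<delta>2 by (intro exI[of _ "min \<delta>1 \<delta>2"] conjI allI impI main) auto
qed

lemma Lipschitz_imp_abs_continuous_on:
  fixes f :: "real \<Rightarrow> real"
  assumes B: "B > 0" and L: "\<And>x y. x \<in> S \<Longrightarrow> y \<in> S \<Longrightarrow> \<bar>f x - f y\<bar> \<le> B * \<bar>x - y\<bar>"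
  shows "abs_continuous_on S f"
  unfolding abs_continuous_on_def
proof (intro allI impI)
  fix \<epsilon> :: real assume \<epsilon>: "\<epsilon> > 0"
  have main: "(\<Sum>K\<in>\<D>. \<bar>f (Sup K) - f (Inf K)\<bar>) < \<epsilon>"
    if \<D>: "\<D> division_of T" "T \<subseteq> S" "(\<Sum>K\<in>\<D>. Sup K - Inf K) < \<epsilon> / B" for \<D> T
  proof -
    have "(\<Sum>K\<in>\<D>. \<bar>f (Sup K) - f (Inf K)\<bar>) \<le> (\<Sum>K\<in>\<D>. B * (Sup K - Inf K))"
    proof (rule sum_mono)
      fix K assume K: "K \<in> \<D>"
      then obtain u v where "K = {u..v}" "K \<noteq> {}" "K \<subseteq> S"
        using division_ofD(2-4)[OF \<D>(1)] \<D>(2) by (metis box_real(2) order_trans)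
      then have "Inf K \<in> S" "Sup K \<in> S" "Inf K \<le> Sup K" by auto
      then show "\<bar>f (Sup K) - f (Inf K)\<bar> \<le> B * (Sup K - Inf K)" using L[of "Sup K" "Inf K"] by simp
    qed
    also have "\<dots> = B * (\<Sum>K\<in>\<D>. Sup K - Inf K)" by (simp add: sum_distrib_left)
    also have "\<dots> < \<epsilon>" using \<D>(3) B by (simp add: pos_less_divide_eq mult.commute)
    finally show ?thesis .
  qed
  show "\<exists>\<delta>>0. \<forall>\<D> T. \<D> division_of T \<and> T \<subseteq> S \<and> (\<Sum>K\<in>\<D>. Sup K - Inf K) < \<delta> \<longrightarrow>
      (\<Sum>K\<in>\<D>. \<bar>f (Sup K) - f (Inf K)\<bar>) < \<epsilon>"
    using \<epsilon> B by (intro exI[of _ "\<epsilon> / B"] conjI allI impI main) auto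
qed

lemma C1_imp_abs_continuous_on:
  fixes f f' :: "real \<Rightarrow> real"
  assumes "\<And>x. x \<in> {a..b} \<Longrightarrow> (f has_real_derivative f' x) (at x within {a..b})"
    and "continuous_on {a..b} f'"
  shows "abs_continuous_on {a..b} f"
proof -
  obtain B where B: "B > 0" "\<And>x. x \<in> {a..b} \<Longrightarrow> \<bar>f' x\<bar> \<le> B"
    using compact_continuous_abs_bound[OF assms(2)] by auto
  show ?thesis
  proof (rule Lipschitz_imp_abs_continuous_on[OF B(1)])
    show "\<bar>f x - f y\<bar> \<le> B * \<bar>x - y\<bar>" if "x \<in> {a..b}" "y \<in> {a..b}" for x y
      using field_differentiable_bound[of "{a..b}" f f' B x y] assms(1) B(2) that by simp
  qed
qed

lemma set_integrable_continuous_mult: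
  fixes f g :: "real \<Rightarrow> real"
  assumes "continuous_on {0..1} f" "set_integrable lebesgue {0..1} g"
  shows "set_integrable lebesgue {0..1} (\<lambda>x. f x * g x)"
  using assms
  by (intro absolutely_integrable_bounded_measurable_product_real continuous_imp_measurable_on_sets_lebesgue
      compact_imp_bounded compact_continuous_image) auto

section \<open>Derivative and energy of functions in \<open>H01\<close>\<close>

context
  fixes h :: "real \<Rightarrow> real"
  assumes h: "h \<in> H01"
begin

lemma H01_abs_continuous: "abs_continuous_on {0..1} h"
  using h by (simp add: H01_def)

lemma H01_continuous: "continuous_on {0..1} h"
  by (rule abs_continuous_on_imp_continuous_on[OF H01_abs_continuous]) simp

lemma H01_deriv_AE:
  obtains N where "negligible N"
    "\<And>x. x \<in> {0..1} - N \<Longrightarrow> (h has_real_derivative deriv h x) (at x within {0..1})"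
proof (rule that[OF abs_continuous_on_negligible_not_differentiable[OF H01_abs_continuous]])
  fix x assume "x \<in> {0..1} - {x \<in> {0..1}. \<not> h field_differentiable at x}"
  then show "(h has_real_derivative deriv h x) (at x within {0..1})"
    by (auto simp: DERIV_deriv_iff_field_differentiable intro: has_field_derivative_at_within)
qed

lemma H01_deriv_square_integrable: "set_integrable lebesgue {0..1} (\<lambda>x. (deriv h x)\<^sup>2)"
  using h by (simp add: H01_def)

text \<open>Square integrability says nothing directly about measurability of
  \<open>deriv h\<close>; that comes from its being a Henstock--Kurzweil integrable function. The
  inequality between \<open>2 * t\<close> and \<open>1 + t\<^sup>2\<close> then provides an
  integrable bound.\<close>

lemma H01_deriv_integrable: "set_integrable lebesgue {0..1} (deriv h)"
proof (rule measurable_bounded_by_integrable_imp_absolutely_integrable)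
  obtain N where N: "negligible N"
    "\<And>x. x \<in> {0..1} - N \<Longrightarrow> (h has_real_derivative deriv h x) (at x within {0..1})"
    using H01_deriv_AE by blast
  have "deriv h integrable_on {0..1}"
    using has_integral_abs_continuous_on[OF H01_abs_continuous _ N] by auto
  then show "deriv h \<in> borel_measurable (lebesgue_on {0..1})" by (rule integrable_imp_measurable)
  show "(\<lambda>x. 1 + (deriv h x)\<^sup>2) integrable_on {0..1}"
    using set_lebesgue_integral_eq_integral(1)[OF H01_deriv_square_integrable]
    by (intro integrable_add) auto
  show "norm (deriv h x) \<le> 1 + (deriv h x)\<^sup>2" for x
    using sum_squares_bound[of 1 "\<bar>deriv h x\<bar>"] by simp
qed auto

lemma H01_energy_integrable:
  assumes "continuous_on {0..1} P" "continuous_on {0..1} Q"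
  shows "set_integrable lebesgue {0..1} (\<lambda>x. P x * (deriv h x)\<^sup>2 + Q x * (h x)\<^sup>2)"
  using assms H01_continuous
  by (intro set_integral_add set_integrable_continuous_mult H01_deriv_square_integrable
      absolutely_integrable_continuous_real continuous_intros) auto

text \<open>The integrand is almost everywhere the derivative of the absolutely continuous function
  \<open>m * h\<^sup>2\<close>, which vanishes at both ends.\<close>

lemma H01_null_lagrangian:
  assumes m: "\<And>x. x \<in> {0..1} \<Longrightarrow> (m has_real_derivative m' x) (at x within {0..1})"
    and m': "continuous_on {0..1} m'"
  shows "set_integrable lebesgue {0..1} (\<lambda>x. m' x * (h x)\<^sup>2 + 2 * m x * h x * deriv h x)"
    and "(LINT x:{0..1}|lebesgue. m' x * (h x)\<^sup>2 + 2 * m x * h x * deriv h x) = 0"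
proof -
  have mc: "continuous_on {0..1} m" by (rule DERIV_continuous_on[OF m])
  show I: "set_integrable lebesgue {0..1} (\<lambda>x. m' x * (h x)\<^sup>2 + 2 * m x * h x * deriv h x)"
    using mc m' H01_continuous
    by (intro set_integral_add set_integrable_continuous_mult H01_deriv_integrable
      absolutely_integrable_continuous_real continuous_intros) auto
  obtain N where N: "negligible N"
    "\<And>x. x \<in> {0..1} - N \<Longrightarrow> (h has_real_derivative deriv h x) (at x within {0..1})"
    using H01_deriv_AE by blast
  have "((\<lambda>x. m' x * (h x)\<^sup>2 + 2 * m x * h x * deriv h x) has_integral
      m 1 * (h 1 * h 1) - m 0 * (h 0 * h 0)) {0..1}"
  proof (rule has_integral_abs_continuous_on[OF _ _ N(1)])
    show "abs_continuous_on {0..1} (\<lambda>x. m x * (h x * h x))"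
      by (intro abs_continuous_on_mult H01_abs_continuous C1_imp_abs_continuous_on[OF m m'])
    show "((\<lambda>x. m x * (h x * h x)) has_real_derivative m' x * (h x)\<^sup>2 + 2 * m x * h x * deriv h x)
        (at x within {0..1})" if "x \<in> {0..1} - N" for x
      using m[of x] N(2)[OF that] that
      by (auto intro!: derivative_eq_intros simp: power2_eq_square algebra_simps)
  qed simp
  moreover have "h 0 = 0" "h 1 = 0" using h by (simp_all add: H01_def)
  ultimately show "(LINT x:{0..1}|lebesgue. m' x * (h x)\<^sup>2 + 2 * m x * h x * deriv h x) = 0"
    unfolding set_lebesgue_integral_eq_integral(2)[OF I] by (simp add: integral_unique)
qed

end

text \<open>Adding a null Lagrangian leaves the functional unchanged, so it suffices to bound the
  modified integrand pointwise. Here \<open>y\<close> and \<open>z\<close> stand for the values of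
  \<open>h\<close> and \<open>deriv h\<close> at \<open>x\<close>.\<close>

lemma cond_C3_of_calibration:
  assumes PQ: "continuous_on {0..1} P" "continuous_on {0..1} Q" and \<gamma>: "\<gamma> > 0"
    and m: "\<And>x. x \<in> {0..1} \<Longrightarrow> (m has_real_derivative m' x) (at x within {0..1})"
    and m': "continuous_on {0..1} m'"
    and ge: "\<And>x y z. x \<in> {0..1} \<Longrightarrow>
      \<gamma> * (z\<^sup>2 + y\<^sup>2) \<le> P x * z\<^sup>2 + Q x * y\<^sup>2 + (m' x * y\<^sup>2 + 2 * m x * y * z)"
  shows "cond_C3 P Q"
  unfolding cond_C3_def
proof (intro exI[of _ \<gamma>] conjI ballI \<gamma>)
  fix h assume h: "h \<in> H01"
  note E = H01_energy_integrable[OF h PQ] and L = H01_null_lagrangian[OF h m m']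
  have N: "set_integrable lebesgue {0..1} (\<lambda>x. (deriv h x)\<^sup>2 + (h x)\<^sup>2)"
    using H01_energy_integrable[OF h, of "\<lambda>_. 1" "\<lambda>_. 1"] by simp
  have "\<gamma> * (LINT x:{0..1}|lebesgue. (deriv h x)\<^sup>2 + (h x)\<^sup>2)
      = (LINT x:{0..1}|lebesgue. \<gamma> * ((deriv h x)\<^sup>2 + (h x)\<^sup>2))" by simp
  also have "\<dots> \<le> (LINT x:{0..1}|lebesgue. (P x * (deriv h x)\<^sup>2 + Q x * (h x)\<^sup>2)
      + (m' x * (h x)\<^sup>2 + 2 * m x * h x * deriv h x))"
    using N by (intro set_integral_mono set_integral_add(1)[OF E L(1)] ge) auto
  also have "\<dots> = Gamma_functional P Q h"
    using set_integral_add(2)[OF E L(1)] L(2) by (simp add: Gamma_functional_def)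
  finally show "\<gamma> * (LINT x:{0..1}|lebesgue. (deriv h x)\<^sup>2 + (h x)\<^sup>2) \<le> Gamma_functional P Q h" .
qed

lemma cond_C2_imp_C3:
  assumes PQ: "continuous_on {0..1} P" "continuous_on {0..1} Q"
    and \<alpha>: "\<alpha> > 0" "\<And>x. x \<in> {0..1} \<Longrightarrow> P x \<ge> \<alpha>"
    and C2: "cond_C2 P Q"
  shows "cond_C3 P Q"
proof -
  obtain w where w: "\<And>x. x \<in> {0..1} \<Longrightarrow> (w has_real_derivative (w x)\<^sup>2 / P x - Q x) (at x within {0..1})"
    using C2 unfolding cond_C2_def solves_R_def by blast
  have wc: "continuous_on {0..1} w" by (rule DERIV_continuous_on[OF w])
  have P0: "P x > 0" if "x \<in> {0..1}" for x using \<alpha> that by force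
  then have Pn: "\<forall>x\<in>{0..1}. P x \<noteq> 0" by force
  define I where "I = (\<lambda>x. integral {0..x} (\<lambda>t. w t / P t))"
  have I: "(I has_real_derivative w x / P x) (at x within {0..1})" if "x \<in> {0..1}" for x
    unfolding I_def using that wc PQ Pn
    by (intro integral_has_real_derivative continuous_on_divide) auto
  obtain B where B: "B > 0" "\<And>x. x \<in> {0..1} \<Longrightarrow> \<bar>I x\<bar> \<le> B"
    using compact_continuous_abs_bound[OF DERIV_continuous_on[OF I]] by auto
  \<comment> \<open>An integrating factor: the derivative of \<open>E\<close> produces exactly the
    cross term \<open>2 * w * (c * x * E) / P\<close> of \<open>m\<^sup>2 / P\<close>, so the two
    cancel.\<close>
  define E where "E = (\<lambda>x. exp (2 * I x))"
  have E: "(E has_real_derivative E x * (2 * (w x / P x))) (at x within {0..1})" if "x \<in> {0..1}" for x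
    unfolding E_def using I[OF that] by (auto intro!: derivative_eq_intros)
  have Ec: "continuous_on {0..1} E" by (rule DERIV_continuous_on[OF E])
  have Eb: "exp (- 2 * B) \<le> E x" "E x \<le> exp (2 * B)" if "x \<in> {0..1}" for x
    using B(2)[OF that] by (auto simp: E_def abs_le_iff)
  \<comment> \<open>Small enough that the remaining quadratic term
    \<open>c * x\<^sup>2 * E x / P x\<close> is at most one half.\<close>
  define c where "c = \<alpha> / (2 * exp (2 * B))"
  have c: "c > 0" using \<alpha> by (simp add: c_def)
  define m where "m = (\<lambda>x. w x + c * x * E x)"
  define m' where "m' = (\<lambda>x. (w x)\<^sup>2 / P x - Q x + c * E x + c * x * (E x * (2 * (w x / P x))))"
  have m: "(m has_real_derivative m' x) (at x within {0..1})" if "x \<in> {0..1}" for x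
    unfolding m_def m'_def using w[OF that] E[OF that] by (auto intro!: derivative_eq_intros)
  have m'c: "continuous_on {0..1} m'"
    unfolding m'_def using wc Ec PQ Pn by (intro continuous_intros) auto
  obtain W where W: "W > 0" "\<And>x. x \<in> {0..1} \<Longrightarrow> \<bar>m x\<bar> \<le> W"
    using compact_continuous_abs_bound[OF DERIV_continuous_on[OF m]] by auto
  \<comment> \<open>The least value of \<open>c * E\<close> that the bound on \<open>I\<close>
    guarantees, times the remaining factor one half.\<close>
  define \<beta> where "\<beta> = c * exp (- 2 * B) / 2"
  have \<beta>: "\<beta> > 0" using c by (simp add: \<beta>_def)
  have super: "m' x + Q x - (m x)\<^sup>2 / P x \<ge> \<beta>" if x: "x \<in> {0..1}" for x
  proof -
    have "m' x + Q x - (m x)\<^sup>2 / P x = c * E x * (1 - c * x\<^sup>2 * E x / P x)"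
      using P0[OF x] by (simp add: m'_def m_def power2_eq_square field_simps)
    moreover have half: "c * x\<^sup>2 * E x / P x \<le> 1 / 2"
    proof -
      have "x\<^sup>2 \<le> 1" using x by (auto simp: power_le_one)
      then have "c * x\<^sup>2 * E x \<le> c * 1 * exp (2 * B)"
        using Eb[OF x] c by (intro mult_mono mult_left_mono) (auto simp: E_def)
      also have "\<dots> = \<alpha> / 2" by (simp add: c_def)
      also have "\<dots> \<le> P x / 2" using \<alpha>(2)[OF x] by simp
      finally show ?thesis using P0[OF x] by (simp add: field_simps)
    qed
    moreover have "c * exp (- 2 * B) * (1 / 2) \<le> c * E x * (1 - c * x\<^sup>2 * E x / P x)"
    proof (rule mult_mono)
      show "c * exp (- 2 * B) \<le> c * E x" using Eb(1)[OF x] c by (intro mult_left_mono) auto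
      show "1 / 2 \<le> 1 - c * x\<^sup>2 * E x / P x" using half by linarith
      show "0 \<le> c * E x" using c by (simp add: E_def)
    qed simp
    ultimately show ?thesis by (simp add: \<beta>_def)
  qed
  define C where "C = W / \<alpha>"
  \<comment> \<open>With \<open>C\<close> bounding \<open>m / P\<close>, the square
    \<open>z\<^sup>2\<close> is at most \<open>2 * k\<^sup>2 + 2 * C\<^sup>2 * y\<^sup>2\<close> in
    the variables \<open>k\<close>, \<open>y\<close> that complete the square below. The two entries
    of the minimum make \<gamma> fit the coefficients of \<open>k\<^sup>2\<close> and
    \<open>y\<^sup>2\<close>.\<close>
  define \<gamma> where "\<gamma> = min (\<alpha> / 2) (\<beta> / (2 * C\<^sup>2 + 1))"
  have C: "2 * C\<^sup>2 + 1 > 0" by (simp add: add_nonneg_pos)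
  have \<gamma>: "\<gamma> > 0" "2 * \<gamma> \<le> \<alpha>" "\<gamma> * (2 * C\<^sup>2 + 1) \<le> \<beta>"
  proof -
    show "\<gamma> > 0" using \<alpha>(1) \<beta> C by (simp add: \<gamma>_def)
    show "2 * \<gamma> \<le> \<alpha>" unfolding \<gamma>_def by linarith
    have "\<gamma> \<le> \<beta> / (2 * C\<^sup>2 + 1)" unfolding \<gamma>_def by (rule min.cobounded2)
    then show "\<gamma> * (2 * C\<^sup>2 + 1) \<le> \<beta>" using C by (simp add: pos_le_divide_eq)
  qed
  show ?thesis
  proof (rule cond_C3_of_calibration[OF PQ \<gamma>(1) m m'c])
    fix x y z :: real assume x: "x \<in> {0..1}"
    define k where "k = z + m x * y / P x"
    have sq: "P x * z\<^sup>2 + Q x * y\<^sup>2 + (m' x * y\<^sup>2 + 2 * m x * y * z)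
        = P x * k\<^sup>2 + (m' x + Q x - (m x)\<^sup>2 / P x) * y\<^sup>2"
      using P0[OF x] by (simp add: k_def power2_eq_square field_simps)
    have "z = k - m x / P x * y" by (simp add: k_def)
    then have "z\<^sup>2 \<le> 2 * k\<^sup>2 + 2 * (m x / P x * y)\<^sup>2"
      using sum_squares_bound[of k "- (m x / P x * y)"] by (simp add: power2_diff)
    also have "(m x / P x * y)\<^sup>2 \<le> C\<^sup>2 * y\<^sup>2"
    proof -
      have "\<bar>m x / P x\<bar> \<le> C"
        unfolding C_def abs_divide using W x \<alpha> P0[OF x] by (intro frac_le) auto
      then have "(m x / P x)\<^sup>2 \<le> C\<^sup>2" by (metis abs_ge_zero power2_abs power_mono)
      then show ?thesis unfolding power_mult_distrib by (rule mult_right_mono) simp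
    qed
    finally have "z\<^sup>2 + y\<^sup>2 \<le> 2 * k\<^sup>2 + (2 * C\<^sup>2 + 1) * y\<^sup>2" by (simp add: algebra_simps)
    then have "\<gamma> * (z\<^sup>2 + y\<^sup>2) \<le> \<gamma> * (2 * k\<^sup>2 + (2 * C\<^sup>2 + 1) * y\<^sup>2)"
      using \<gamma>(1) by (intro mult_left_mono) auto
    also have "\<dots> = (2 * \<gamma>) * k\<^sup>2 + (\<gamma> * (2 * C\<^sup>2 + 1)) * y\<^sup>2" by (simp add: algebra_simps)
    also have "\<dots> \<le> P x * k\<^sup>2 + (m' x + Q x - (m x)\<^sup>2 / P x) * y\<^sup>2"
      using \<gamma>(2,3) \<alpha>(2)[OF x] super[OF x] by (intro add_mono mult_right_mono) auto
    finally show "\<gamma> * (z\<^sup>2 + y\<^sup>2) \<le> P x * z\<^sup>2 + Q x * y\<^sup>2 + (m' x * y\<^sup>2 + 2 * m x * y * z)"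
      unfolding sq .
  qed
qed

section \<open>The equivalences\<close>

lemma cond_C1_imp_C2:
  assumes P: "\<And>x. x \<in> {0..1} \<Longrightarrow> P x > 0" and C1: "cond_C1 P Q"
  shows "cond_C2 P Q"
proof -
  obtain u u' where u: "\<And>x. x \<in> {0..1} \<Longrightarrow> (u has_real_derivative u' x) (at x within {0..1})"
    "\<And>x. x \<in> {0..1} \<Longrightarrow> ((\<lambda>x. P x * u' x) has_real_derivative Q x * u x) (at x within {0..1})"
    and pos: "\<And>x. x \<in> {0..1} \<Longrightarrow> u x > 0"
    using C1 unfolding cond_C1_def solves_L_def by blast
  define w where "w = (\<lambda>x. - (P x * u' x) / u x)"
  have w: "(w has_real_derivative (w x)\<^sup>2 / P x - Q x) (at x within {0..1})" if x: "x \<in> {0..1}" for x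
  proof -
    have "(w has_real_derivative (- (Q x * u x) * u x - - (P x * u' x) * u' x) / (u x * u x)) (at x within {0..1})"
      unfolding w_def using pos[OF x] by (intro DERIV_divide DERIV_minus u x) auto
    moreover have "(- (Q x * u x) * u x - - (P x * u' x) * u' x) / (u x * u x) = (w x)\<^sup>2 / P x - Q x"
      using pos[OF x] P[OF x] by (simp add: w_def power2_eq_square field_simps)
    ultimately show ?thesis by simp
  qed
  moreover have "bounded (w ` {0..1})"
    by (intro compact_imp_bounded compact_continuous_image DERIV_continuous_on[OF w]) auto
  ultimately show ?thesis unfolding cond_C2_def solves_R_def by blast
qed

text \<open>Reading the substitution backwards, \<open>u' / u = - w / P\<close> is solved by an
  exponential, which is positive.\<close>

lemma cond_C2_imp_C1:
  assumes P: "continuous_on {0..1} P" "\<And>x. x \<in> {0..1} \<Longrightarrow> P x > 0" and C2: "cond_C2 P Q"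
  shows "cond_C1 P Q"
proof -
  obtain w where w: "\<And>x. x \<in> {0..1} \<Longrightarrow> (w has_real_derivative (w x)\<^sup>2 / P x - Q x) (at x within {0..1})"
    using C2 unfolding cond_C2_def solves_R_def by blast
  have Pn: "\<forall>x\<in>{0..1}. P x \<noteq> 0" using P(2) by force
  define u where "u = (\<lambda>x. exp (- integral {0..x} (\<lambda>t. w t / P t)))"
  define u' where "u' = (\<lambda>x. - (w x / P x) * u x)"
  have u: "(u has_real_derivative u' x) (at x within {0..1})" if "x \<in> {0..1}" for x
  proof -
    have "((\<lambda>x. integral {0..x} (\<lambda>t. w t / P t)) has_real_derivative w x / P x) (at x within {0..1})"
      using that P(1) Pn by (intro integral_has_real_derivative continuous_on_divide DERIV_continuous_on[OF w]) auto
    then show ?thesis unfolding u_def u'_def by (auto intro!: derivative_eq_intros)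
  qed
  have "((\<lambda>x. P x * u' x) has_real_derivative Q x * u x) (at x within {0..1})" if x: "x \<in> {0..1}" for x
  proof (rule has_field_derivative_transform_within[OF _ zero_less_one x])
    \<comment> \<open>On \<open>{0..1}\<close> the factor \<open>P\<close> cancels, and the product
      \<open>w * u\<close> can be differentiated by (R) and the equation for
      \<open>u\<close>.\<close>
    show "- (w y * u y) = P y * u' y" if "y \<in> {0..1}" for y
      using Pn that by (simp add: u'_def)
    have "((\<lambda>y. - (w y * u y)) has_real_derivative - (((w x)\<^sup>2 / P x - Q x) * u x + u' x * w x)) (at x within {0..1})"
      by (intro DERIV_minus DERIV_mult w u x)
    also have "- (((w x)\<^sup>2 / P x - Q x) * u x + u' x * w x) = Q x * u x"
      using Pn x by (simp add: u'_def power2_eq_square field_simps)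
    finally show "((\<lambda>y. - (w y * u y)) has_real_derivative Q x * u x) (at x within {0..1})" .
  qed
  with u have "solves_L P Q u" unfolding solves_L_def by blast
  then show ?thesis unfolding cond_C1_def by (intro exI[of _ u]) (simp add: u_def)
qed

section \<open>Initial value problems and positivity\<close>

text \<open>With \<open>v = P * u'\<close> as second unknown, (L) becomes a first-order system with
  coefficients \<open>1 / P\<close> and \<open>Q\<close>; the slope \<open>d\<close> at 0 becomes
  the initial value \<open>P 0 * d\<close>.\<close>

lemma solves_L_exists:
  assumes P: "continuous_on {0..1} P" "\<And>x. x \<in> {0..1} \<Longrightarrow> P x > 0" and Q: "continuous_on {0..1} Q"
  obtains u where "solves_L P Q u" "u 0 = c" "(u has_real_derivative d) (at 0 within {0..1})"
proof -
  have Pn: "\<forall>x\<in>{0..1}. P x \<noteq> 0" using P(2) by force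
  obtain u v where uv: "u 0 = c" "v 0 = P 0 * d"
    "\<And>x. x \<in> {0..1} \<Longrightarrow> (u has_real_derivative 1 / P x * v x) (at x within {0..1})"
    "\<And>x. x \<in> {0..1} \<Longrightarrow> (v has_real_derivative Q x * u x) (at x within {0..1})"
    using linear_system_exists[OF continuous_on_divide[OF continuous_on_const P(1) Pn] Q] by blast
  have "((\<lambda>x. P x * (1 / P x * v x)) has_real_derivative Q x * u x) (at x within {0..1})" if "x \<in> {0..1}" for x
    using Pn by (intro has_field_derivative_transform_within[OF uv(4)[OF that] zero_less_one that]) auto
  then have "solves_L P Q u"
    unfolding solves_L_def using uv(3) by (intro exI[of _ "\<lambda>x. 1 / P x * v x"]) blast
  moreover have "(u has_real_derivative d) (at 0 within {0..1})"
    using uv(3)[of 0] uv(2) Pn by simp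
  ultimately show thesis using that uv(1) by blast
qed

lemma solves_L_continuous:
  assumes "solves_L P Q u" shows "continuous_on {0..1} u"
  using assms unfolding solves_L_def by (meson DERIV_continuous_on)

text \<open>The slope 1 at 0 makes \<open>u\<close> positive just to the right of 0. A later value
  that is not positive would force a zero \<open>a\<close> in between, and (C4) would make
  \<open>u\<close> vanish on \<open>{0..a}\<close>, contradicting the early positivity.\<close>

lemma cond_C4_imp_C5:
  assumes P: "continuous_on {0..1} P" "\<And>x. x \<in> {0..1} \<Longrightarrow> P x > 0" and Q: "continuous_on {0..1} Q"
    and C4: "cond_C4 P Q"
  shows "cond_C5 P Q"
proof -
  have "0 < u x" if ivp: "solves_L_ivp P Q u" and x: "x \<in> {0<..1}" for u x
  proof (rule ccontr)
    assume neg: "\<not> 0 < u x"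
    have u: "solves_L P Q u" "u 0 = 0" "(u has_real_derivative 1) (at 0 within {0..1})"
      using ivp by (auto simp: solves_L_ivp_def)
    obtain d where d: "d > 0" "\<And>k. k > 0 \<Longrightarrow> 0 + k \<in> {0..1} \<Longrightarrow> k < d \<Longrightarrow> u 0 < u (0 + k)"
      using has_real_derivative_pos_inc_right[OF u(3)] by auto
    define y where "y = min (d / 2) x"
    have y: "0 < y" "y < d" "y \<le> x" using d x by (auto simp: y_def)
    have uy: "u y > 0" using d(2)[of y] y x u(2) by simp
    have "continuous_on {y..x} u"
      using y x by (intro continuous_on_subset[OF solves_L_continuous[OF u(1)]]) auto
    then obtain a where a: "y \<le> a" "a \<le> x" "u a = 0"
      using IVT2'[of u x 0 y] neg uy y by auto
    then have "\<forall>x\<in>{0..a}. u x = 0"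
      using C4 u y x unfolding cond_C4_def by (meson greaterThanAtMost_iff less_le_trans order_trans)
    then have "u y = 0" using y a by auto
    with uy show False by simp
  qed
  moreover have "\<exists>u. solves_L_ivp P Q u"
    using solves_L_exists[OF P Q, of 0 1] unfolding solves_L_ivp_def by metis
  ultimately show ?thesis unfolding cond_C5_def by blast
qed

text \<open>Near 0, where \<open>u\<close> is small, the solution \<open>v\<close> with
  \<open>v 0 = 1\<close> is positive; away from 0, \<open>u\<close> has a positive minimum that a
  small multiple of \<open>v\<close> cannot destroy.\<close>

lemma cond_C5_imp_C1:
  assumes P: "continuous_on {0..1} P" "\<And>x. x \<in> {0..1} \<Longrightarrow> P x > 0" and Q: "continuous_on {0..1} Q"
    and C5: "cond_C5 P Q"
  shows "cond_C1 P Q"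
proof -
  obtain u where u: "solves_L P Q u" "u 0 = 0" "\<And>x. x \<in> {0<..1} \<Longrightarrow> u x > 0"
    using C5 unfolding cond_C5_def solves_L_ivp_def by blast
  obtain v where v: "solves_L P Q v" "v 0 = 1" using solves_L_exists[OF P Q, of 1 0] by blast
  note uc = solves_L_continuous[OF u(1)] and vc = solves_L_continuous[OF v(1)]
  obtain \<eta> where \<eta>: "\<eta> > 0" "\<And>x. x \<in> {0..1} \<Longrightarrow> \<bar>x\<bar> < \<eta> \<Longrightarrow> v x > 0"
  proof -
    obtain \<eta> where "\<eta> > 0" "\<And>x. x \<in> {0..1} \<Longrightarrow> dist x 0 < \<eta> \<Longrightarrow> dist (v x) (v 0) < 1"
      using vc unfolding continuous_on_iff by (metis atLeastAtMost_iff order_refl zero_le_one zero_less_one)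
    then show thesis using that v(2) by (force simp: dist_real_def)
  qed
  \<comment> \<open>The cap at 1 keeps \<open>{\<kappa>..1}\<close> nonempty, so that
    \<open>u\<close> attains a minimum there.\<close>
  define \<kappa> where "\<kappa> = min \<eta> 1"
  have \<kappa>: "0 < \<kappa>" "\<kappa> \<le> 1" "\<kappa> \<le> \<eta>" using \<eta> by (auto simp: \<kappa>_def)
  obtain x0 where x0: "x0 \<in> {\<kappa>..1}" "\<And>x. x \<in> {\<kappa>..1} \<Longrightarrow> u x0 \<le> u x"
    using continuous_attains_inf[of "{\<kappa>..1}" u] \<kappa> continuous_on_subset[OF uc, of "{\<kappa>..1}"] by auto
  have c: "u x0 > 0" using u(3)[of x0] x0(1) \<kappa> by auto
  obtain M where M: "M > 0" "\<And>x. x \<in> {0..1} \<Longrightarrow> \<bar>v x\<bar> \<le> M"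
    using compact_continuous_abs_bound[OF vc compact_Icc] by blast
  define \<epsilon> where "\<epsilon> = u x0 / (2 * M)"
  have \<epsilon>: "\<epsilon> > 0" "\<epsilon> * M < u x0" using c M(1) by (auto simp: \<epsilon>_def)
  obtain u' v' where
    u': "\<And>x. x \<in> {0..1} \<Longrightarrow> (u has_real_derivative u' x) (at x within {0..1})"
      "\<And>x. x \<in> {0..1} \<Longrightarrow> ((\<lambda>x. P x * u' x) has_real_derivative Q x * u x) (at x within {0..1})" and
    v': "\<And>x. x \<in> {0..1} \<Longrightarrow> (v has_real_derivative v' x) (at x within {0..1})"
      "\<And>x. x \<in> {0..1} \<Longrightarrow> ((\<lambda>x. P x * v' x) has_real_derivative Q x * v x) (at x within {0..1})"
    using u(1) v(1) unfolding solves_L_def by blast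
  have "solves_L P Q (\<lambda>x. u x + \<epsilon> * v x)"
    unfolding solves_L_def
  proof (intro exI[of _ "\<lambda>x. u' x + \<epsilon> * v' x"] ballI conjI)
    fix x :: real assume x: "x \<in> {0..1}"
    show "((\<lambda>x. u x + \<epsilon> * v x) has_real_derivative u' x + \<epsilon> * v' x) (at x within {0..1})"
      by (intro DERIV_add DERIV_cmult u' v' x)
    have "((\<lambda>x. P x * u' x + \<epsilon> * (P x * v' x)) has_real_derivative Q x * u x + \<epsilon> * (Q x * v x)) (at x within {0..1})"
      by (intro DERIV_add DERIV_cmult u' v' x)
    then show "((\<lambda>x. P x * (u' x + \<epsilon> * v' x)) has_real_derivative Q x * (u x + \<epsilon> * v x)) (at x within {0..1})"
      by (simp add: algebra_simps)
  qed
  moreover have "u x + \<epsilon> * v x > 0" if x: "x \<in> {0..1}" for x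
  proof (cases "x < \<kappa>")
    case True
    then have "v x > 0" "u x \<ge> 0"
      using \<eta>(2)[of x] \<kappa> x u(2) u(3)[of x] by (auto simp: le_less)
    then show ?thesis using \<epsilon>(1) by (simp add: add_nonneg_pos)
  next
    case False
    then have "u x0 \<le> u x" using x0(2) x by auto
    moreover have "\<bar>\<epsilon> * v x\<bar> \<le> \<epsilon> * M"
      unfolding abs_mult using M(2)[OF x] \<epsilon>(1) by (intro mult_mono) auto
    ultimately show ?thesis using \<epsilon>(2) by linarith
  qed
  ultimately show ?thesis unfolding cond_C1_def by blast
qed

section \<open>Extension of a solution by zero\<close>

text \<open>\<open>G\<close> is left free at 0, \<open>a\<close> and 1, where the derivative of an
  extension by zero is not controlled; these points form a null set.\<close>

lemma set_integral_cutoff: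
  fixes F G :: "real \<Rightarrow> real"
  assumes a: "0 < a" "a \<le> 1" and F: "continuous_on {0..a} F"
    and G: "\<And>x. 0 < x \<Longrightarrow> x < a \<Longrightarrow> G x = F x" "\<And>x. a < x \<Longrightarrow> x < 1 \<Longrightarrow> G x = 0"
  shows "set_integrable lebesgue {0..1} G" "(LINT x:{0..1}|lebesgue. G x) = integral {0..a} F"
proof -
  define H where "H = (\<lambda>x. if x \<in> {0..a} then F x else 0)"
  have eq: "indicator {0..1} x *\<^sub>R H x = indicator {0..a} x *\<^sub>R F x" for x :: real
    using a by (auto simp: H_def indicator_def)
  have IF: "set_integrable lebesgue {0..a} F" by (rule absolutely_integrable_continuous_real[OF F])
  then have IH: "set_integrable lebesgue {0..1} H"
    unfolding set_integrable_def eq .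
  have GH: "G x = H x" if "x \<in> {0..1} - {0, a, 1}" for x
    using that G[of x] by (cases "x < a") (auto simp: H_def)
  show IG: "set_integrable lebesgue {0..1} G"
    by (rule absolutely_integrable_spike[OF IH, of "{0, a, 1}"]) (auto simp: GH)
  have "(LINT x:{0..1}|lebesgue. G x) = integral {0..1} G"
    by (rule set_lebesgue_integral_eq_integral(2)[OF IG])
  also have "\<dots> = integral {0..1} H"
    by (rule integral_spike[of "{0, a, 1}"]) (auto simp: GH)
  also have "\<dots> = (LINT x:{0..1}|lebesgue. H x)"
    by (rule set_lebesgue_integral_eq_integral(2)[OF IH, symmetric])
  also have "\<dots> = (LINT x:{0..a}|lebesgue. F x)"
    unfolding set_lebesgue_integral_def eq ..
  also have "\<dots> = integral {0..a} F"
    by (rule set_lebesgue_integral_eq_integral(2)[OF IF])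
  finally show "(LINT x:{0..1}|lebesgue. G x) = integral {0..a} F" .
qed

lemma cond_C3_imp_C4:
  assumes P: "continuous_on {0..1} P" "\<And>x. x \<in> {0..1} \<Longrightarrow> P x > 0" and Q: "continuous_on {0..1} Q"
    and C3: "cond_C3 P Q"
  shows "cond_C4 P Q"
  unfolding cond_C4_def
proof (intro allI impI, elim conjE)
  fix u a assume L: "solves_L P Q u" and a: "0 < a" "a \<le> 1" and ua: "u 0 = 0" "u a = 0"
  have Pn: "\<forall>x\<in>{0..1}. P x \<noteq> 0" using P(2) by force
  obtain u' where u': "\<And>x. x \<in> {0..1} \<Longrightarrow> (u has_real_derivative u' x) (at x within {0..1})"
    "\<And>x. x \<in> {0..1} \<Longrightarrow> ((\<lambda>x. P x * u' x) has_real_derivative Q x * u x) (at x within {0..1})"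
    using L unfolding solves_L_def by blast
  have uc: "continuous_on {0..1} u" by (rule solves_L_continuous[OF L])
  \<comment> \<open>(L) gives differentiability of \<open>P * u'\<close> only; dividing by
    \<open>P\<close> yields continuity of \<open>u'\<close>.\<close>
  have "continuous_on {0..1} (\<lambda>x. P x * u' x / P x)"
    by (intro continuous_on_divide DERIV_continuous_on[OF u'(2)] P(1) Pn)
  also have "continuous_on {0..1} (\<lambda>x. P x * u' x / P x) \<longleftrightarrow> continuous_on {0..1} u'"
    using Pn by (intro continuous_on_cong) auto
  finally have u'c: "continuous_on {0..1} u'" .
  have sub: "{0..a} \<subseteq> {0..1}" using a by auto
  note conts = continuous_on_subset[OF uc sub] continuous_on_subset[OF u'c sub]
    continuous_on_subset[OF P(1) sub] continuous_on_subset[OF Q sub]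
  \<comment> \<open>Because \<open>u a = 0\<close>, freezing the argument at \<open>a\<close>
    extends \<open>u\<close> by zero. As \<open>min\<close> is 1-Lipschitz in \<open>x\<close>, the
    Lipschitz bound of \<open>u\<close> carries over to \<open>h\<close>.\<close>
  define h where "h = (\<lambda>x. u (min x a))"
  have h1: "h x = u x" if "x \<le> a" for x using that by (simp add: h_def)
  have h2: "h x = 0" if "a \<le> x" for x using that ua by (simp add: h_def min_absorb2)
  have d1: "deriv h x = u' x" if "0 < x" "x < a" for x
  proof -
    have "(u has_real_derivative u' x) (at x)"
      using u'(1)[of x] that a at_within_interior[of x "{0..1}"] by simp
    then have "(h has_real_derivative u' x) (at x)"
    proof (rule has_field_derivative_transform_within_open)
      show "open {..<a}" "x \<in> {..<a}" using that by auto
    qed (simp add: h1)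
    then show ?thesis by (rule DERIV_imp_deriv)
  qed
  have d2: "deriv h x = 0" if "a < x" for x
  proof -
    have "(h has_real_derivative 0) (at x)"
    proof (rule has_field_derivative_transform_within_open[OF DERIV_const])
      show "open {a<..}" "x \<in> {a<..}" using that by auto
    qed (simp add: h2)
    then show ?thesis by (rule DERIV_imp_deriv)
  qed
  \<comment> \<open>The coefficients \<open>(1, 0)\<close> give membership in \<open>H01\<close>,
    \<open>(P, Q)\<close> the functional, and \<open>(1, 1)\<close> the squared norm.\<close>
  have cut: "set_integrable lebesgue {0..1} (\<lambda>x. f x * (deriv h x)\<^sup>2 + g x * (h x)\<^sup>2)"
    "(LINT x:{0..1}|lebesgue. f x * (deriv h x)\<^sup>2 + g x * (h x)\<^sup>2) = integral {0..a} (\<lambda>x. f x * (u' x)\<^sup>2 + g x * (u x)\<^sup>2)"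
    if "continuous_on {0..a} f" "continuous_on {0..a} g" for f g
    by (rule set_integral_cutoff[OF a], use that conts in \<open>auto intro!: continuous_intros simp: d1 d2 h1 h2\<close>)+
  have "h \<in> H01"
  proof -
    obtain B where B: "B > 0" "\<And>x. x \<in> {0..1} \<Longrightarrow> \<bar>u' x\<bar> \<le> B"
      using compact_continuous_abs_bound[OF u'c compact_Icc] by blast
    have "abs_continuous_on {0..1} h"
    proof (rule Lipschitz_imp_abs_continuous_on[OF B(1)])
      fix x y :: real assume xy: "x \<in> {0..1}" "y \<in> {0..1}"
      have "norm (u (min x a) - u (min y a)) \<le> B * norm (min x a - min y a)"
        using xy a B(2) by (intro field_differentiable_bound[of "{0..1}" u u' B] u'(1)) auto
      also have "\<dots> \<le> B * \<bar>x - y\<bar>" using B(1) by (intro mult_left_mono) auto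
      finally show "\<bar>h x - h y\<bar> \<le> B * \<bar>x - y\<bar>" by (simp add: h_def)
    qed
    moreover have "set_integrable lebesgue {0..1} (\<lambda>x. (deriv h x)\<^sup>2)"
      using cut(1)[of "\<lambda>_. 1" "\<lambda>_. 0"] by simp
    ultimately show ?thesis
      using h1[of 0] h2[of 1] a ua by (simp add: H01_def)
  qed
  then obtain \<gamma> where \<gamma>: "\<gamma> > 0"
    "Gamma_functional P Q h \<ge> \<gamma> * (LINT x:{0..1}|lebesgue. (deriv h x)\<^sup>2 + (h x)\<^sup>2)"
    using C3 unfolding cond_C3_def by blast
  \<comment> \<open>By (L) the energy density is the derivative of \<open>P * u' * u\<close>, which
    vanishes at 0 and at \<open>a\<close>.\<close>
  have "((\<lambda>x. P x * (u' x)\<^sup>2 + Q x * (u x)\<^sup>2) has_integral P a * u' a * u a - P 0 * u' 0 * u 0) {0..a}"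
  proof (rule fundamental_theorem_of_calculus)
    fix x assume x: "x \<in> {0..a}"
    then have x1: "x \<in> {0..1}" using sub by auto
    have "((\<lambda>x. P x * u' x * u x) has_real_derivative Q x * u x * u x + u' x * (P x * u' x)) (at x within {0..1})"
      by (intro DERIV_mult u' x1)
    then have "((\<lambda>x. P x * u' x * u x) has_real_derivative P x * (u' x)\<^sup>2 + Q x * (u x)\<^sup>2) (at x within {0..1})"
      by (simp add: power2_eq_square algebra_simps)
    then show "((\<lambda>x. P x * u' x * u x) has_vector_derivative P x * (u' x)\<^sup>2 + Q x * (u x)\<^sup>2) (at x within {0..a})"
      unfolding has_real_derivative_iff_has_vector_derivative using sub by (rule has_vector_derivative_within_subset)
  qed (use a in simp)
  then have "Gamma_functional P Q h = 0"
    unfolding Gamma_functional_def cut(2)[OF conts(3,4)] using ua by (simp add: integral_unique)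
  moreover have "(LINT x:{0..1}|lebesgue. (deriv h x)\<^sup>2 + (h x)\<^sup>2) = integral {0..a} (\<lambda>x. (u' x)\<^sup>2 + (u x)\<^sup>2)"
    using cut(2)[of "\<lambda>_. 1" "\<lambda>_. 1"] by simp
  ultimately have "integral {0..a} (\<lambda>x. (u' x)\<^sup>2 + (u x)\<^sup>2) \<le> 0"
    using \<gamma> by (simp add: mult_le_0_iff)
  moreover have "integral {0..a} (\<lambda>x. (u' x)\<^sup>2 + (u x)\<^sup>2) \<ge> 0"
    using conts by (intro integral_nonneg integrable_continuous_real continuous_intros) auto
  ultimately have "integral {0..a} (\<lambda>x. (u' x)\<^sup>2 + (u x)\<^sup>2) = 0" by simp
  then have "\<forall>x\<in>{0..a}. (u' x)\<^sup>2 + (u x)\<^sup>2 = 0"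
    using conts a by (subst (asm) integral_eq_0_iff) (auto intro!: continuous_intros)
  then show "\<forall>x\<in>{0..a}. u x = 0" by (simp add: sum_power2_eq_zero_iff)
qed

theorem theorem2p1:
  fixes P Q :: "real \<Rightarrow> real"
  assumes "Ck_on 1 {0..1} P"
    and "Ck_on 0 {0..1} Q"
    and "\<exists>\<alpha>>0. \<forall>x\<in>{0..1}. P x \<ge> \<alpha>"
  shows "(cond_C1 P Q \<longleftrightarrow> cond_C2 P Q) \<and>
         (cond_C2 P Q \<longleftrightarrow> cond_C3 P Q) \<and>
         (cond_C3 P Q \<longleftrightarrow> cond_C4 P Q) \<and>
         (cond_C4 P Q \<longleftrightarrow> cond_C5 P Q)"
proof -
  obtain P' where "\<And>x. x \<in> {0..1} \<Longrightarrow> (P has_real_derivative P' x) (at x within {0..1})"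
    using assms(1) by (auto simp only: One_nat_def Ck_on.simps)
  then have P: "continuous_on {0..1} P" by (rule DERIV_continuous_on)
  have Q: "continuous_on {0..1} Q" using assms(2) by simp
  obtain \<alpha> where \<alpha>: "\<alpha> > 0" "\<And>x. x \<in> {0..1} \<Longrightarrow> P x \<ge> \<alpha>" using assms(3) by blast
  then have pos: "\<And>x. x \<in> {0..1} \<Longrightarrow> P x > 0" by force
  \<comment> \<open>The implications close the cycle from (C1) through (C2), (C3), (C4), (C5) back
    to (C1).\<close>
  show ?thesis
    using cond_C1_imp_C2[of P Q, OF pos] cond_C2_imp_C1[OF P pos] cond_C2_imp_C3[OF P Q \<alpha>]
      cond_C3_imp_C4[OF P pos Q] cond_C4_imp_C5[OF P pos Q] cond_C5_imp_C1[OF P pos Q] by blast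
qed

end
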